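(* Let $G$ be a finite simple graph that contains no fork and no odd parachute as an induced subgraph. If $G$ is nonperfectly divisible (i.e. not perfectly divisible), then $G$ contains a trisimplicial vertex.
   Context: All graphs are finite and simple. A clique is a set of pairwise adjacent vertices (the empty set is allowed), and $\omega(G)$ is the maximum size of a clique of $G$; $\chi(G)$ is the chromatic number. For $X\subseteq V(G)$, $G[X]$ is the subgraph of $G$ induced by $X$. A graph $G$ is perfect if $\chi(H)=\omega(H)$ for every induced subgraph $H$ of $G$. A graph $G$ is perfectly divisible if for every induced subgraph $H$ of $G$ (with at least one vertex), $V(H)$ can be partitioned into two sets $A$ and $B$ (possibly empty) such that $H[A]$ is perfect and $\omega(H[B])<\omega(H)$ (with $\omega=0$ for the graph with no vertices). A graph is nonperfectly divisible if it is not perfectly divisible. A fork is the graph obtained from the claw $K_{1,3}$ by subdividing one edge exactly once (so it has 5 vertices and 4 edges). A hole is an induced cycle of length at least four; here it is also used for the cycle graph itself. An odd parachute is a graph obtained from a cycle $H$ of odd length at least five by adding two new vertices $u,v$ and the edge $uv$, such that $u$ is adjacent to every vertex of $H$ and $v$ is adjacent to no vertex of $H$. "Contains no odd parachute" means that no induced subgraph of $G$ is isomorphic to any odd parachute, for any odd cycle length at least five. A vertex of a graph is trisimplicial if its (open) neighbourhood is the union of three cliques. *)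

theory Defs
  imports Main "HOL-Library.Ramsey"
begin

text \<open>
  Graphs follow the convention of \<^theory>\<open>HOL-Library.Ramsey\<close>, whose
  \<^const>\<open>clique\<close> is used below: edges are two-element sets of vertices.
\<close>

record 'a ugraph =
  verts :: "'a set"
  edges :: "'a set set"

definition simple_graph :: "'a ugraph \<Rightarrow> bool" where
  "simple_graph G \<longleftrightarrow> finite (verts G) \<and> (\<forall>e\<in>edges G. e \<subseteq> verts G \<and> card e = 2)"

definition neighbourhood :: "'a ugraph \<Rightarrow> 'a \<Rightarrow> 'a set" where
  "neighbourhood G v = {u \<in> verts G. {u, v} \<in> edges G}"

definition induce :: "'a ugraph \<Rightarrow> 'a set \<Rightarrow> 'a ugraph" where
  "induce G X = \<lparr>verts = X, edges = {e \<in> edges G. e \<subseteq> X}\<rparr>"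

definition induced_subgraph :: "'a ugraph \<Rightarrow> 'a ugraph \<Rightarrow> bool" where
  "induced_subgraph H G \<longleftrightarrow> (\<exists>X \<subseteq> verts G. H = induce G X)"

definition graph_iso :: "'a ugraph \<Rightarrow> 'b ugraph \<Rightarrow> bool" where
  "graph_iso G H \<longleftrightarrow>
     (\<exists>f. bij_betw f (verts G) (verts H) \<and>
        (\<forall>u\<in>verts G. \<forall>v\<in>verts G. {u, v} \<in> edges G \<longleftrightarrow> {f u, f v} \<in> edges H))"

definition contains_induced :: "'a ugraph \<Rightarrow> 'b ugraph \<Rightarrow> bool" where
  "contains_induced G F \<longleftrightarrow> (\<exists>H. induced_subgraph H G \<and> graph_iso F H)"

definition clique_in :: "'a ugraph \<Rightarrow> 'a set \<Rightarrow> bool" where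
  "clique_in G K \<longleftrightarrow> K \<subseteq> verts G \<and> clique K (edges G)"

definition clique_number :: "'a ugraph \<Rightarrow> nat" where
  "clique_number G = Max {card K | K. clique_in G K}"

definition proper_colouring :: "'a ugraph \<Rightarrow> nat \<Rightarrow> ('a \<Rightarrow> nat) \<Rightarrow> bool" where
  "proper_colouring G k c \<longleftrightarrow>
     (\<forall>v\<in>verts G. c v < k) \<and>
     (\<forall>u\<in>verts G. \<forall>v\<in>verts G. {u, v} \<in> edges G \<longrightarrow> c u \<noteq> c v)"

definition chromatic_number :: "'a ugraph \<Rightarrow> nat" where
  "chromatic_number G = (LEAST k. \<exists>c. proper_colouring G k c)"

definition perfect :: "'a ugraph \<Rightarrow> bool" where
  "perfect G \<longleftrightarrow>
     (\<forall>H. induced_subgraph H G \<longrightarrow> chromatic_number H = clique_number H)"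

definition perfectly_divisible :: "'a ugraph \<Rightarrow> bool" where
  "perfectly_divisible G \<longleftrightarrow>
     (\<forall>H. induced_subgraph H G \<and> verts H \<noteq> {} \<longrightarrow>
        (\<exists>A B. A \<union> B = verts H \<and> A \<inter> B = {} \<and>
           perfect (induce H A) \<and> clique_number (induce H B) < clique_number H))"

text \<open>The claw with centre \<open>0\<close> and leaves \<open>1, 2, 4\<close>, where \<open>3\<close> subdivides the edge \<open>{0, 4}\<close>.\<close>

definition fork :: "nat ugraph" where
  "fork = \<lparr>verts = {0, 1, 2, 3, 4}, edges = {{0, 1}, {0, 2}, {0, 3}, {3, 4}}\<rparr>"

text \<open>Meaningful for \<open>n \<ge> 3\<close> only; for smaller \<open>n\<close> the result is degenerate.\<close>

definition cycle_graph :: "nat \<Rightarrow> nat ugraph" where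
  "cycle_graph n = \<lparr>verts = {..<n}, edges = {{i, Suc i mod n} | i. i < n}\<rparr>"

text \<open>The vertices \<open>u\<close> and \<open>v\<close> added to the cycle are \<open>n\<close> and \<open>Suc n\<close>, respectively.\<close>

definition parachute :: "nat \<Rightarrow> nat ugraph" where
  "parachute n =
     \<lparr>verts = verts (cycle_graph n) \<union> {n, Suc n},
      edges = edges (cycle_graph n) \<union> {{n, i} | i. i \<in> verts (cycle_graph n)} \<union> {{n, Suc n}}\<rparr>"

definition odd_parachute :: "nat ugraph \<Rightarrow> bool" where
  "odd_parachute P \<longleftrightarrow> (\<exists>n. odd n \<and> 5 \<le> n \<and> P = parachute n)"

definition trisimplicial :: "'a ugraph \<Rightarrow> 'a \<Rightarrow> bool" where
  "trisimplicial G v \<longleftrightarrow>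
     v \<in> verts G \<and>
     (\<exists>K\<^sub>1 K\<^sub>2 K\<^sub>3. clique_in G K\<^sub>1 \<and> clique_in G K\<^sub>2 \<and> clique_in G K\<^sub>3 \<and>
        neighbourhood G v = K\<^sub>1 \<union> K\<^sub>2 \<union> K\<^sub>3)"

lemma simple_graph_induce:
  "simple_graph G \<Longrightarrow> X \<subseteq> verts G \<Longrightarrow> simple_graph (induce G X)"
  by (auto simp: simple_graph_def induce_def intro: finite_subset)

lemma simple_graph_fork: "simple_graph fork"
  by (simp add: simple_graph_def fork_def card_insert_if)

lemma simple_graph_cycle_graph:
  assumes "3 \<le> n"
  shows "simple_graph (cycle_graph n)"
proof -
  have "i \<noteq> Suc i mod n" if "i < n" for i
    using that assms by (cases "Suc i = n") auto
  then show ?thesis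
    using assms by (auto simp: simple_graph_def cycle_graph_def)
qed

lemma simple_graph_parachute:
  assumes "3 \<le> n"
  shows "simple_graph (parachute n)"
  using simple_graph_cycle_graph[OF assms]
  by (auto simp: simple_graph_def parachute_def cycle_graph_def)

end

theory Submission
  imports Defs
begin

text \<open>
  Suppose the graph is not perfectly divisible, let \<open>M\<close> be a minimal vertex set that is not
  divisible, and \<open>v \<in> M\<close>. The non-neighbours of \<open>v\<close> in \<open>M\<close> induce an imperfect graph and hence
  contain a minimal imperfect set \<open>D\<close>. Neither \<open>M\<close> (for imperfect sets) nor \<open>D\<close> has a nontrivial
  homogeneous set, by substitution, and this yields in a fork-free graph a vertex \<open>s\<close> mixed on
  \<open>D\<close> with a neighbour \<open>w\<close> anticomplete to \<open>D\<close>. Forks through \<open>w\<close> and \<open>s\<close> then show that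
  \<open>X = D \<inter> N(s)\<close> is a clique each of whose vertices has a clique as its neighbourhood in \<open>D - X\<close>,
  and a Kempe chain argument finds an odd hole in \<open>D\<close>. This replaces the strong perfect graph
  theorem.

  Let \<open>C\<close> be this odd hole and \<open>v\<close> now a vertex at distance exactly two from it. Since there is no
  odd parachute, a common neighbour of \<open>v\<close> and \<open>C\<close> is attached to \<open>C\<close> at one edge. Excluding forks,
  the neighbourhood of \<open>v\<close> has no stable set of size three, and sorting it by the edges of \<open>C\<close>
  covers it by three cliques.
\<close>

section \<open>Perfect sets of vertices and substitution\<close>

text \<open>A minimal imperfect set has no visible structure of its own. The vertex \<open>s\<close>
  is sought because a vertex that sees \<open>w\<close> and a proper nonempty part of
  \<open>D\<close> provides, together with \<open>w\<close>, the outer vertices of forks that reach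
  into \<open>D\<close>.

  The Kempe argument works because inside \<open>D\<close> the neighbourhood of a vertex of
  \<open>X\<close> is a union of two cliques, so that each colour occurs there at most twice.
  Colours that occur once yield to chains in the usual way. To cope with those that occur twice, the
  uncoloured vertex is also moved about in \<open>X\<close>, and the outcome is either a chain that
  closes to an odd hole or a clique with too many vertices.

  The three cliques are built around one attached vertex \<open>u\<close>: its non-neighbours, the
  vertices at its own edge of \<open>C\<close>, and its remaining neighbours. No choice of
  \<open>u\<close> works only if every attached vertex in the neighbourhood of \<open>v\<close> is
  the middle one of three at consecutive edges. This forces \<open>C\<close> to have length five,
  and that case has a cover of its own.\<close>

locale adjacency =
  fixes adj :: "'a \<Rightarrow> 'a \<Rightarrow> bool" (infix "\<sim>" 50)
  assumes adj_sym: "x \<sim> y \<Longrightarrow> y \<sim> x"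
    and adj_irrefl: "\<not> x \<sim> x"
begin

lemma adj_commute: "x \<sim> y \<longleftrightarrow> y \<sim> x"
  using adj_sym by blast

definition cliq :: "'a set \<Rightarrow> bool" where
  "cliq K \<longleftrightarrow> (\<forall>x\<in>K. \<forall>y\<in>K. x \<noteq> y \<longrightarrow> x \<sim> y)"

definition stable :: "'a set \<Rightarrow> bool" where
  "stable I \<longleftrightarrow> (\<forall>x\<in>I. \<forall>y\<in>I. \<not> x \<sim> y)"

definition om :: "'a set \<Rightarrow> nat" where
  "om S = Max (card ` {K. K \<subseteq> S \<and> cliq K})"

definition colouring :: "'a set \<Rightarrow> nat \<Rightarrow> ('a \<Rightarrow> nat) \<Rightarrow> bool" where
  "colouring S k c \<longleftrightarrow> (\<forall>v\<in>S. c v < k) \<and> (\<forall>u\<in>S. \<forall>v\<in>S. u \<sim> v \<longrightarrow> c u \<noteq> c v)"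

text \<open>No colouring of \<open>T\<close> has fewer than \<open>om T\<close> colours, so a
  colouring with \<open>om T\<close> colours expresses equality of the two numbers without speaking
  of the chromatic number.\<close>

definition perf :: "'a set \<Rightarrow> bool" where
  "perf S \<longleftrightarrow> (\<forall>T\<subseteq>S. \<exists>c. colouring T (om T) c)"

lemma cliqD: "cliq K \<Longrightarrow> x \<in> K \<Longrightarrow> y \<in> K \<Longrightarrow> x \<noteq> y \<Longrightarrow> x \<sim> y"
  unfolding cliq_def by blast

lemma cliq_subset: "cliq K \<Longrightarrow> L \<subseteq> K \<Longrightarrow> cliq L"
  unfolding cliq_def by blast

lemma cliq_insert: "cliq K \<Longrightarrow> (\<And>y. y \<in> K \<Longrightarrow> y \<noteq> x \<Longrightarrow> x \<sim> y) \<Longrightarrow> cliq (insert x K)"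
  unfolding cliq_def using adj_sym by blast

lemma cliq_Un:
  "cliq K \<Longrightarrow> cliq L \<Longrightarrow> (\<And>x y. x \<in> K \<Longrightarrow> y \<in> L \<Longrightarrow> x \<noteq> y \<Longrightarrow> x \<sim> y) \<Longrightarrow> cliq (K \<union> L)"
  unfolding cliq_def using adj_sym by blast

lemma finite_cliqs: "finite S \<Longrightarrow> finite (card ` {K. K \<subseteq> S \<and> cliq K})"
  by simp

lemma card_le_om:
  assumes "finite S" "K \<subseteq> S" "cliq K"
  shows "card K \<le> om S"
  unfolding om_def by (rule Max_ge) (use assms in auto)

lemma ex_max_cliq:
  assumes "finite S"
  obtains K where "K \<subseteq> S" "cliq K" "card K = om S"
proof -
  have "card ` {K. K \<subseteq> S \<and> cliq K} \<noteq> {}"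
    by (auto simp: cliq_def)
  from Max_in[OF finite_cliqs[OF assms] this] show ?thesis
    unfolding om_def[symmetric] using that by auto
qed

lemma om_lessI:
  assumes "finite S" "\<And>K. K \<subseteq> S \<Longrightarrow> cliq K \<Longrightarrow> card K < k"
  shows "om S < k"
  using ex_max_cliq[OF assms(1)] assms(2) by metis

lemma om_leI:
  assumes "finite S" "\<And>K. K \<subseteq> S \<Longrightarrow> cliq K \<Longrightarrow> card K \<le> k"
  shows "om S \<le> k"
  using ex_max_cliq[OF assms(1)] assms(2) by metis

lemma om_mono: "finite S \<Longrightarrow> T \<subseteq> S \<Longrightarrow> om T \<le> om S"
  by (rule om_leI) (auto intro: card_le_om finite_subset)

lemma colouring_less: "colouring S k c \<Longrightarrow> v \<in> S \<Longrightarrow> c v < k"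
  unfolding colouring_def by blast

lemma colouring_neq: "colouring S k c \<Longrightarrow> u \<in> S \<Longrightarrow> v \<in> S \<Longrightarrow> u \<sim> v \<Longrightarrow> c u \<noteq> c v"
  unfolding colouring_def by blast

lemma colouringI:
  "(\<And>v. v \<in> S \<Longrightarrow> c v < k) \<Longrightarrow>
   (\<And>u v. u \<in> S \<Longrightarrow> v \<in> S \<Longrightarrow> u \<sim> v \<Longrightarrow> c u \<noteq> c v) \<Longrightarrow> colouring S k c"
  unfolding colouring_def by blast

lemma colouring_inj_on: "colouring S k c \<Longrightarrow> K \<subseteq> S \<Longrightarrow> cliq K \<Longrightarrow> inj_on c K"
  unfolding colouring_def cliq_def inj_on_def by blast

lemma om_le_colouring:
  assumes "finite S" "colouring S k c"
  shows "om S \<le> k"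
proof (rule om_leI[OF assms(1)])
  fix K assume K: "K \<subseteq> S" "cliq K"
  have "card K \<le> card {..<k}"
    by (rule card_inj_on_le[OF colouring_inj_on[OF assms(2) K]])
      (use assms(2) K in \<open>auto simp: colouring_def\<close>)
  then show "card K \<le> k" by simp
qed

lemma colouring_mono: "colouring S k c \<Longrightarrow> T \<subseteq> S \<Longrightarrow> k \<le> l \<Longrightarrow> colouring T l c"
  unfolding colouring_def by (meson le_trans not_le subsetD order_less_le_trans)

lemma perf_subset: "perf S \<Longrightarrow> T \<subseteq> S \<Longrightarrow> perf T"
  unfolding perf_def by blast

text \<open>A clique with as many vertices as there are colours meets every colour class, so the
  class of \<open>p\<close> will do. The prescribed vertex is used for \<open>p0\<close> in the
  substitution lemma.\<close>

lemma perf_stable: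
  assumes "finite S" "perf S" "T \<subseteq> S" "p \<in> T"
  shows "\<exists>I\<subseteq>T. p \<in> I \<and> stable I \<and> (\<forall>K\<subseteq>T. cliq K \<longrightarrow> card K = om T \<longrightarrow> K \<inter> I \<noteq> {})"
proof -
  obtain c where c: "colouring T (om T) c"
    using assms(2,3) unfolding perf_def by blast
  let ?I = "{v \<in> T. c v = c p}"
  have "K \<inter> ?I \<noteq> {}" if K: "K \<subseteq> T" "cliq K" "card K = om T" for K
  proof -
    have "c ` K \<subseteq> {..<om T}" using c K(1) by (auto simp: colouring_def)
    moreover have "card (c ` K) = om T"
      using card_image[OF colouring_inj_on[OF c K(1,2)]] K(3) by simp
    ultimately have "c ` K = {..<om T}" by (simp add: card_subset_eq)
    moreover have "c p < om T" using c assms(4) by (auto simp: colouring_def)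
    ultimately obtain v where "v \<in> K" "c v = c p" by (metis imageE lessThan_iff)
    then show ?thesis using K(1) by blast
  qed
  moreover have "\<not> x \<sim> y" if "x \<in> ?I" "y \<in> ?I" for x y
    using colouring_neq[OF c, of x y] that by auto
  then have "stable ?I" unfolding stable_def by blast
  moreover have "?I \<subseteq> T" "p \<in> ?I" using assms(4) by auto
  ultimately show ?thesis by blast
qed

text \<open>Removing the stable set lowers the clique number, which leaves a colour for it. With
  \<open>perf_stable\<close>, this describes perfection without colours, as suits sets glued from
  two pieces.\<close>

lemma perfI_stable:
  assumes fin: "finite S"
    and hit: "\<And>T. T \<subseteq> S \<Longrightarrow> T \<noteq> {} \<Longrightarrow>
      \<exists>I\<subseteq>T. stable I \<and> (\<forall>K\<subseteq>T. cliq K \<longrightarrow> card K = om T \<longrightarrow> K \<inter> I \<noteq> {})"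
  shows "perf S"
proof -
  have "\<exists>c. colouring T (om T) c" if "T \<subseteq> S" for T
    using that
  proof (induction "card T" arbitrary: T rule: less_induct)
    case less
    have finT: "finite T" using less.prems fin finite_subset by blast
    show ?case
    proof (cases "T = {}")
      case True
      then have "colouring T (om T) c" for c by (simp add: colouring_def)
      then show ?thesis by blast
    next
      case False
      obtain I where I: "I \<subseteq> T" "stable I"
        and hitI: "\<And>K. K \<subseteq> T \<Longrightarrow> cliq K \<Longrightarrow> card K = om T \<Longrightarrow> K \<inter> I \<noteq> {}"
        using hit[OF less.prems False] by blast
      have lt: "om (T - I) < om T"
      proof (rule om_lessI)
        fix K assume K: "K \<subseteq> T - I" "cliq K"
        then have "card K \<le> om T" by (intro card_le_om[OF finT]) auto
        moreover have "card K \<noteq> om T" using hitI[of K] K by auto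
        ultimately show "card K < om T" by simp
      qed (use finT in simp)
      have "I \<noteq> {}" using lt by auto
      then have "card (T - I) < card T"
        using I(1) finT by (intro psubset_card_mono) auto
      then obtain c where c: "colouring (T - I) (om (T - I)) c"
        using less.hyps[of "T - I"] less.prems by blast
      have "colouring T (om T) (\<lambda>v. if v \<in> I then om (T - I) else c v)"
        unfolding colouring_def
      proof (intro conjI ballI impI)
        fix v assume "v \<in> T"
        then show "(if v \<in> I then om (T - I) else c v) < om T"
          using c lt unfolding colouring_def by (auto intro: less_trans)
      next
        fix u v assume "u \<in> T" "v \<in> T" "u \<sim> v"
        then show "(if u \<in> I then om (T - I) else c u) \<noteq> (if v \<in> I then om (T - I) else c v)"
          using c I(2) unfolding colouring_def stable_def
          by (metis Diff_iff less_irrefl)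
      qed
      then show ?thesis by blast
    qed
  qed
  then show ?thesis unfolding perf_def by blast
qed

text \<open>
  The vertex \<open>p0\<close> stands for the place into which \<open>P\<close> is substituted; it need not belong to \<open>P\<close>.
\<close>

lemma perf_substitution:
  assumes fin: "finite P" "finite Q" and disj: "P \<inter> Q = {}" and p0: "p0 \<notin> Q"
    and hom: "\<And>q. q \<in> Q \<Longrightarrow> (\<forall>p\<in>insert p0 P. q \<sim> p) \<or> (\<forall>p\<in>insert p0 P. \<not> q \<sim> p)"
    and perfP: "perf P" and perfQ: "perf (insert p0 Q)"
  shows "perf (P \<union> Q)"
proof (rule perfI_stable)
  show "finite (P \<union> Q)" using fin by simp
  fix T assume T: "T \<subseteq> P \<union> Q" "T \<noteq> {}"
  have finT: "finite T" using T(1) fin finite_subset by blast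
  show "\<exists>I\<subseteq>T. stable I \<and> (\<forall>K\<subseteq>T. cliq K \<longrightarrow> card K = om T \<longrightarrow> K \<inter> I \<noteq> {})"
  proof (cases "T \<inter> P = {}")
    case True
    obtain t where "t \<in> T" using T(2) by blast
    moreover have "T \<subseteq> insert p0 Q" using T(1) True by blast
    ultimately show ?thesis
      using perf_stable[OF _ perfQ, of T t] fin by auto
  next
    case False
    then obtain p where p: "p \<in> T" "p \<in> P" by blast
    obtain I1 where I1: "I1 \<subseteq> T \<inter> P" "stable I1"
      and hit1: "\<And>K. K \<subseteq> T \<inter> P \<Longrightarrow> cliq K \<Longrightarrow> card K = om (T \<inter> P) \<Longrightarrow> K \<inter> I1 \<noteq> {}"
      using perf_stable[OF fin(1) perfP, of "T \<inter> P" p] p by blast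
    let ?T = "insert p0 (T \<inter> Q)"
    obtain I2 where I2: "I2 \<subseteq> ?T" "p0 \<in> I2" "stable I2"
      and hit2: "\<And>K. K \<subseteq> ?T \<Longrightarrow> cliq K \<Longrightarrow> card K = om ?T \<Longrightarrow> K \<inter> I2 \<noteq> {}"
      using perf_stable[OF _ perfQ, of ?T p0] fin by blast
    \<comment> \<open>\<open>I1\<close> takes the place of \<open>p0\<close> in
      \<open>I2\<close>.\<close>
    let ?I = "I1 \<union> (I2 - {p0})"
    have "\<not> q \<sim> r" if "q \<in> I2 - {p0}" "r \<in> I1" for q r
    proof -
      have "\<not> q \<sim> p0" using that I2 unfolding stable_def by blast
      then show ?thesis using hom[of q] that I1(1) I2(1) by blast
    qed
    then have "stable ?I"
      using I1(2) I2(3) unfolding stable_def by (metis Diff_iff Un_iff adj_sym)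
    moreover have "K \<inter> ?I \<noteq> {}" if K: "K \<subseteq> T" "cliq K" "card K = om T" for K
    proof (cases "K \<inter> P = {}")
      case True
      then have KQ: "K \<subseteq> T \<inter> Q" using K(1) T(1) by blast
      \<comment> \<open>A clique through \<open>p0\<close> keeps its size when \<open>p\<close>
        replaces \<open>p0\<close>. Hence \<open>K\<close>, which avoids \<open>P\<close>, is a
        maximum clique of \<open>?T\<close> as well.\<close>
      have "om ?T \<le> om T"
      proof (rule om_leI)
        fix L assume L: "L \<subseteq> ?T" "cliq L"
        show "card L \<le> om T"
        proof (cases "p0 \<in> L")
          case True
          let ?L = "insert p (L - {p0})"
          have "p \<sim> l" if "l \<in> L - {p0}" for l
          proof -
            have "l \<sim> p0" using True that L(2) unfolding cliq_def by blast
            then show ?thesis using hom[of l] that L(1) p adj_sym by blast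
          qed
          then have "cliq ?L"
            by (intro cliq_insert cliq_subset[OF L(2)]) auto
          moreover have "?L \<subseteq> T" using L(1) p by blast
          moreover have "card ?L = card L"
          proof -
            have "finite L" using L(1) finT by (meson finite_Int finite_insert finite_subset)
            moreover have "p \<notin> L - {p0}" using L(1) p disj by blast
            ultimately show ?thesis using True
              by (metis card_insert_disjoint finite_Diff insert_Diff Diff_iff insertI1)
          qed
          ultimately show ?thesis using card_le_om[OF finT] by metis
        next
          case False
          then show ?thesis using L by (intro card_le_om[OF finT]) auto
        qed
      qed (use finT in simp)
      moreover have "card K \<le> om ?T"
        using KQ finT K(2) by (intro card_le_om) auto
      ultimately have "K \<inter> I2 \<noteq> {}" using hit2[of K] K KQ by auto
      then show ?thesis using KQ p0 by blast
    next
      case False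
      then obtain r where r: "r \<in> K" "r \<in> P" by blast
      \<comment> \<open>Exchanging \<open>K \<inter> P\<close> for a maximum clique \<open>L\<close>
        of \<open>T \<inter> P\<close> leaves a clique, so \<open>K \<inter> P\<close> is itself
        maximum there.\<close>
      obtain L where L: "L \<subseteq> T \<inter> P" "cliq L" "card L = om (T \<inter> P)"
        using ex_max_cliq[of "T \<inter> P"] finT by blast
      have "q \<sim> l" if "q \<in> K \<inter> Q" "l \<in> L" for q l
      proof -
        have "q \<noteq> r" using that(1) r(2) disj by blast
        then have "q \<sim> r" using cliqD[OF K(2)] r(1) that(1) by blast
        then show ?thesis using hom[of q] that r L(1) by blast
      qed
      then have "cliq ((K \<inter> Q) \<union> L)"
        by (intro cliq_Un cliq_subset[OF K(2)] L(2)) auto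
      moreover have "(K \<inter> Q) \<union> L \<subseteq> T" using K(1) L(1) by blast
      ultimately have "card ((K \<inter> Q) \<union> L) \<le> card K"
        using card_le_om[OF finT] K(3) by simp
      moreover have finK: "finite K" and "finite L"
        using K(1) L(1) finT finite_subset by blast+
      moreover have "(K \<inter> Q) \<inter> L = {}" using L(1) disj by blast
      ultimately have le: "card (K \<inter> Q) + card L \<le> card K"
        by (simp add: card_Un_disjoint)
      have "card K = card ((K \<inter> Q) \<union> (K \<inter> P))"
        by (rule arg_cong[where f = card]) (use K(1) T(1) in blast)
      also have "\<dots> = card (K \<inter> Q) + card (K \<inter> P)"
        by (rule card_Un_disjoint) (use finK disj in auto)
      finally have "om (T \<inter> P) \<le> card (K \<inter> P)" using le L(3) by simp
      moreover have "card (K \<inter> P) \<le> om (T \<inter> P)"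
        using K finT by (intro card_le_om) (auto intro: cliq_subset)
      ultimately have "(K \<inter> P) \<inter> I1 \<noteq> {}"
        using hit1[of "K \<inter> P"] K by (auto intro: cliq_subset)
      then show ?thesis by blast
    qed
    moreover have "?I \<subseteq> T" using I1(1) I2(1) by blast
    ultimately show ?thesis by blast
  qed
qed

section \<open>Disjoint unions and joins\<close>

lemma perf_disjoint_Un:
  assumes fin: "finite P" "finite Q" and anti: "\<And>p q. p \<in> P \<Longrightarrow> q \<in> Q \<Longrightarrow> \<not> p \<sim> q"
    and perf: "perf P" "perf Q"
  shows "perf (P \<union> Q)"
  unfolding perf_def
proof (intro allI impI)
  fix T assume T: "T \<subseteq> P \<union> Q"
  have finT: "finite T" using T fin finite_subset by blast
  obtain c d where "colouring (T \<inter> P) (om (T \<inter> P)) c" "colouring (T \<inter> Q) (om (T \<inter> Q)) d"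
    using perf unfolding perf_def by (meson inf_le2)
  then have c: "colouring (T \<inter> P) (om T) c" and d: "colouring (T \<inter> Q) (om T) d"
    using colouring_mono om_mono[OF finT] by (meson inf_le1 order_refl)+
  have "colouring T (om T) (\<lambda>v. if v \<in> P then c v else d v)"
  proof (rule colouringI, goal_cases)
    case (1 v)
    then show ?case using T colouring_less[OF c, of v] colouring_less[OF d, of v] by auto
  next
    case (2 u v)
    then have "(u \<in> P \<and> v \<in> P) \<or> (u \<notin> P \<and> v \<notin> P)"
      using T anti[of u v] anti[of v u] adj_sym[of u v] by blast
    then show ?case
      using 2 T colouring_neq[OF c, of u v] colouring_neq[OF d, of u v] by auto
  qed
  then show "\<exists>c. colouring T (om T) c" by blast
qed

text \<open>If \<open>T\<close> meets \<open>P\<close>, each maximum clique of \<open>T\<close>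
  meets \<open>P\<close> in a maximum clique of \<open>T \<inter> P\<close>, so a stable set that
  hits the latter cliques serves for all of \<open>T\<close>.\<close>

lemma perf_join:
  assumes fin: "finite P" "finite Q" and disj: "P \<inter> Q = {}"
    and join: "\<And>p q. p \<in> P \<Longrightarrow> q \<in> Q \<Longrightarrow> p \<sim> q"
    and perf: "perf P" "perf Q"
  shows "perf (P \<union> Q)"
proof (rule perfI_stable)
  show "finite (P \<union> Q)" using fin by simp
  fix T assume T: "T \<subseteq> P \<union> Q" "T \<noteq> {}"
  have finT: "finite T" using T(1) fin finite_subset by blast
  show "\<exists>I\<subseteq>T. stable I \<and> (\<forall>K\<subseteq>T. cliq K \<longrightarrow> card K = om T \<longrightarrow> K \<inter> I \<noteq> {})"
  proof (cases "T \<inter> P = {}")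
    case True
    obtain t where "t \<in> T" using T(2) by blast
    moreover have "T \<subseteq> Q" using T(1) True by blast
    ultimately show ?thesis
      using perf_stable[OF fin(2) perf(2), of T t] by auto
  next
    case False
    then obtain p where p: "p \<in> T" "p \<in> P" by blast
    obtain I where I: "I \<subseteq> T \<inter> P" "stable I"
      and hit: "\<And>K. K \<subseteq> T \<inter> P \<Longrightarrow> cliq K \<Longrightarrow> card K = om (T \<inter> P) \<Longrightarrow> K \<inter> I \<noteq> {}"
      using perf_stable[OF fin(1) perf(1), of "T \<inter> P" p] p by blast
    have "K \<inter> I \<noteq> {}" if K: "K \<subseteq> T" "cliq K" "card K = om T" for K
    proof -
      obtain L where L: "L \<subseteq> T \<inter> P" "cliq L" "card L = om (T \<inter> P)"
        using ex_max_cliq[of "T \<inter> P"] finT by blast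
      have finK: "finite K" and finL: "finite L"
        using K(1) L(1) finT finite_subset by blast+
      have "q \<sim> l" if "q \<in> K \<inter> Q" "l \<in> L" for q l
        using that L(1) join[of l q] adj_sym by blast
      then have "cliq ((K \<inter> Q) \<union> L)"
        by (intro cliq_Un cliq_subset[OF K(2)] L(2)) auto
      moreover have "(K \<inter> Q) \<union> L \<subseteq> T" using K(1) L(1) by blast
      ultimately have "card ((K \<inter> Q) \<union> L) \<le> card K"
        using card_le_om[OF finT] K(3) by simp
      moreover have "(K \<inter> Q) \<inter> L = {}" using L(1) disj by blast
      ultimately have le: "card (K \<inter> Q) + card L \<le> card K"
        using finK finL by (simp add: card_Un_disjoint)
      have "card K = card ((K \<inter> Q) \<union> (K \<inter> P))"
        by (rule arg_cong[where f = card]) (use K(1) T(1) in blast)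
      also have "\<dots> = card (K \<inter> Q) + card (K \<inter> P)"
        by (rule card_Un_disjoint) (use finK disj in auto)
      finally have "om (T \<inter> P) \<le> card (K \<inter> P)" using le L(3) by simp
      moreover have "card (K \<inter> P) \<le> om (T \<inter> P)"
        using K finT by (intro card_le_om) (auto intro: cliq_subset)
      ultimately have "(K \<inter> P) \<inter> I \<noteq> {}"
        using hit[of "K \<inter> P"] K by (auto intro: cliq_subset)
      then show ?thesis by blast
    qed
    then show ?thesis using I by blast
  qed
qed

lemma cliq_perf:
  assumes "finite K" "cliq K"
  shows "perf K"
  unfolding perf_def
proof (intro allI impI)
  fix T assume T: "T \<subseteq> K"
  have fT: "finite T" using T assms(1) finite_subset by blast
  obtain c where c: "bij_betw c T {0..<card T}"
    using ex_bij_betw_finite_nat[OF fT] by blast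
  have "card T \<le> om T" using card_le_om[OF fT order_refl] cliq_subset[OF assms(2) T] by blast
  moreover have "c v < card T" if "v \<in> T" for v
    using c that by (auto simp: bij_betw_def)
  moreover have "c u \<noteq> c v" if "u \<in> T" "v \<in> T" "u \<sim> v" for u v
    using c that adj_irrefl by (auto simp: bij_betw_def inj_on_def)
  ultimately have "colouring T (om T) c" unfolding colouring_def by (meson order_less_le_trans)
  then show "\<exists>c. colouring T (om T) c" by blast
qed

section \<open>Minimal imperfect sets\<close>

definition min_imperfect :: "'a set \<Rightarrow> bool" where
  "min_imperfect D \<longleftrightarrow> finite D \<and> \<not> perf D \<and> (\<forall>T. T \<subset> D \<longrightarrow> perf T)"

lemma ex_min_imperfect:
  assumes "finite S" "\<not> perf S"
  obtains D where "D \<subseteq> S" "min_imperfect D"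
proof -
  have "\<exists>D\<subseteq>S. min_imperfect D" using assms
  proof (induction S rule: finite_psubset_induct)
    case (psubset S)
    show ?case
    proof (cases "\<forall>T. T \<subset> S \<longrightarrow> perf T")
      case True
      then show ?thesis using psubset unfolding min_imperfect_def by blast
    next
      case False
      then show ?thesis using psubset.IH by (meson order_trans psubset_imp_subset)
    qed
  qed
  then show ?thesis using that by blast
qed

lemma min_imperfect_not_colouring: "min_imperfect D \<Longrightarrow> \<not> colouring D (om D) c"
  unfolding min_imperfect_def perf_def by (metis psubsetI order_refl)

lemma min_imperfect_colouring_delete:
  assumes "min_imperfect D" "x \<in> D"
  obtains c where "colouring (D - {x}) (om D) c"
proof -
  have "perf (D - {x})" using assms unfolding min_imperfect_def by blast
  then obtain c where "colouring (D - {x}) (om (D - {x})) c" unfolding perf_def by blast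
  then have "colouring (D - {x}) (om D) c"
    using assms om_mono[of D "D - {x}"] colouring_mono[of "D - {x}"]
    unfolding min_imperfect_def by blast
  then show ?thesis using that by blast
qed

lemma min_imperfect_connected:
  assumes D: "min_imperfect D" and U: "U \<subseteq> D" "U \<noteq> {}" "U \<noteq> D"
  shows "\<exists>u\<in>U. \<exists>v\<in>D - U. u \<sim> v"
proof (rule ccontr)
  assume "\<not> ?thesis"
  moreover have "perf U" "perf (D - U)" "finite U" "finite (D - U)"
    using D U finite_subset unfolding min_imperfect_def by blast+
  ultimately have "perf (U \<union> (D - U))" by (intro perf_disjoint_Un) auto
  then show False using D U(1) unfolding min_imperfect_def by (simp add: Un_absorb1)
qed

lemma min_imperfect_anticonnected:
  assumes D: "min_imperfect D" and U: "U \<subseteq> D" "U \<noteq> {}" "U \<noteq> D"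
  shows "\<exists>u\<in>U. \<exists>v\<in>D - U. \<not> u \<sim> v"
proof (rule ccontr)
  assume "\<not> ?thesis"
  moreover have "perf U" "perf (D - U)" "finite U" "finite (D - U)"
    using D U finite_subset unfolding min_imperfect_def by blast+
  ultimately have "perf (U \<union> (D - U))" by (intro perf_join) auto
  then show False using D U(1) unfolding min_imperfect_def by (simp add: Un_absorb1)
qed

text \<open>Otherwise \<open>D\<close> arises from \<open>insert p (D - P)\<close> by substituting
  \<open>P\<close> for \<open>p\<close>. The second vertex \<open>p'\<close> makes that set a proper
  subset of \<open>D\<close>, hence perfect.\<close>

lemma min_imperfect_no_homogeneous:
  assumes D: "min_imperfect D" and P: "P \<subset> D" "p \<in> P" "p' \<in> P" "p \<noteq> p'"
  obtains q a b where "q \<in> D - P" "a \<in> P" "b \<in> P" "q \<sim> a" "\<not> q \<sim> b"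
proof -
  have "perf P" "finite P" "finite (D - P)"
    using D P finite_subset unfolding min_imperfect_def by blast+
  moreover have "insert p (D - P) \<subset> D" using P by auto
  then have "perf (insert p (D - P))" using D unfolding min_imperfect_def by blast
  moreover have "P \<union> (D - P) = D" "p \<notin> D - P" "insert p P = P" using P by blast+
  moreover have "\<not> perf D" using D unfolding min_imperfect_def by blast
  ultimately have "\<not> (\<forall>q\<in>D - P. (\<forall>r\<in>P. q \<sim> r) \<or> (\<forall>r\<in>P. \<not> q \<sim> r))"
    using perf_substitution[of P "D - P" p] by auto
  then show ?thesis using that by blast
qed

end

section \<open>Kempe chains and odd holes\<close>

text \<open>In a walk of least length, a repeated vertex or a chord would be a shortcut. The last
  clause speaks of forward pairs only, since \<open>R\<close> may fail to be symmetric.\<close>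

lemma rtrancl_shortest_path:
  assumes "(a, b) \<in> R\<^sup>*"
  obtains p and m :: nat where "p 0 = a" "p m = b" "inj_on p {..m}"
    "\<forall>i<m. (p i, p (Suc i)) \<in> R"
    "\<forall>i j. i < j \<longrightarrow> j \<le> m \<longrightarrow> (p i, p j) \<in> R \<longrightarrow> j = Suc i"
proof -
  define m where "m = (LEAST n. (a, b) \<in> R ^^ n)"
  have ex: "\<exists>n. (a, b) \<in> R ^^ n" using assms by (simp add: rtrancl_power)
  have m: "(a, b) \<in> R ^^ m" unfolding m_def by (rule LeastI_ex[OF ex])
  have least: "m \<le> n" if "(a, b) \<in> R ^^ n" for n
    unfolding m_def using that by (rule Least_le)
  obtain p where p: "p 0 = a" "p m = b" "\<And>i. i < m \<Longrightarrow> (p i, p (Suc i)) \<in> R"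
    using m unfolding relpow_fun_conv by blast
  have seg: "(p i, p (i + d)) \<in> R ^^ d" if "i + d \<le> m" for i d
    unfolding relpow_fun_conv
    by (rule exI[of _ "\<lambda>l. p (i + l)"]) (use p(3) that in auto)
  have "i \<ge> j" if "i \<le> m" "j \<le> m" "p i = p j" for i j
  proof -
    have "(a, p i) \<in> R ^^ i" using seg[of 0 i] p(1) that by simp
    moreover have "(p j, b) \<in> R ^^ (m - j)" using seg[of j "m - j"] p(2) that by simp
    ultimately have "(a, b) \<in> R ^^ (i + (m - j))" using that(3) by (auto simp: relpow_add)
    then show ?thesis using least that by fastforce
  qed
  then have "inj_on p {..m}" by (intro inj_onI) (metis atMost_iff le_antisym)
  moreover have "j = Suc i" if "i < j" "j \<le> m" "(p i, p j) \<in> R" for i j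
  proof -
    have "(a, p i) \<in> R ^^ i" using seg[of 0 i] p(1) that by simp
    moreover have "(p j, b) \<in> R ^^ (m - j)" using seg[of j "m - j"] p(2) that by simp
    ultimately have "(a, b) \<in> R ^^ (Suc i + (m - j))"
      unfolding relpow_add relpow.simps(2) using that(3) by blast
    then have "m \<le> Suc i + (m - j)" by (rule least)
    then show ?thesis using that by linarith
  qed
  ultimately show ?thesis using that p by blast
qed

context adjacency
begin

definition hole :: "nat \<Rightarrow> (nat \<Rightarrow> 'a) \<Rightarrow> bool" where
  "hole n h \<longleftrightarrow> inj_on h {..<n} \<and>
    (\<forall>i<n. \<forall>j<n. h i \<sim> h j \<longleftrightarrow> j = Suc i mod n \<or> i = Suc j mod n)"

definition odd_hole_in :: "'a set \<Rightarrow> bool" where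
  "odd_hole_in S \<longleftrightarrow> (\<exists>n h. odd n \<and> 5 \<le> n \<and> hole n h \<and> h ` {..<n} \<subseteq> S)"

definition bichromatic :: "'a set \<Rightarrow> ('a \<Rightarrow> nat) \<Rightarrow> nat \<Rightarrow> nat \<Rightarrow> ('a \<times> 'a) set" where
  "bichromatic S c i j = {(u, v). u \<in> S \<and> v \<in> S \<and> u \<sim> v \<and> c u \<in> {i, j} \<and> c v \<in> {i, j}}"

text \<open>A chord of a shortest path would itself belong to the relation, so the path is induced.
  Its colours alternate between ends of different colours, which makes the length odd, and
  nonadjacent ends exclude length 1.\<close>

lemma bichromatic_path:
  assumes col: "colouring S k c" and reach: "(a, b) \<in> (bichromatic S c i j)\<^sup>*"
    and ij: "c a = i" "c b = j" "i \<noteq> j" and nadj: "\<not> a \<sim> b"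
  obtains p m where "p 0 = a" "p m = b" "odd m" "3 \<le> m" "inj_on p {..m}"
    "\<forall>l\<le>m. p l \<in> S" "\<forall>l\<le>m. c (p l) = (if even l then i else j)"
    "\<forall>l\<le>m. \<forall>l'\<le>m. p l \<sim> p l' \<longleftrightarrow> l' = Suc l \<or> l = Suc l'"
proof -
  obtain p m where path: "p 0 = a" "p m = b" "inj_on p {..m}"
    "\<forall>i'<m. (p i', p (Suc i')) \<in> bichromatic S c i j"
    "\<forall>i' j'. i' < j' \<longrightarrow> j' \<le> m \<longrightarrow> (p i', p j') \<in> bichromatic S c i j \<longrightarrow> j' = Suc i'"
    using rtrancl_shortest_path[OF reach] by blast
  note p = path[rule_format]
  have m0: "m \<noteq> 0" using p(1,2) ij by metis
  have edge: "p l \<in> S" "p (Suc l) \<in> S" "p l \<sim> p (Suc l)" "c (p l) \<in> {i, j}"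
    "c (p (Suc l)) \<in> {i, j}" if "l < m" for l
    using p(4)[OF that] unfolding bichromatic_def by blast+
  have inS: "p l \<in> S" if "l \<le> m" for l
  proof (cases l)
    case 0
    then show ?thesis using edge(1)[of 0] m0 by simp
  next
    case (Suc l')
    then show ?thesis using edge(2)[of l'] that by simp
  qed
  have cols: "c (p l) = (if even l then i else j)" if "l \<le> m" for l
    using that
  proof (induction l)
    case 0
    then show ?case using p(1) ij by simp
  next
    case (Suc l)
    then have "c (p l) \<noteq> c (p (Suc l))"
      using colouring_neq[OF col, of "p l" "p (Suc l)"] edge[of l] by auto
    moreover have "c (p l) = (if even l then i else j)" using Suc by simp
    moreover have "c (p (Suc l)) = i \<or> c (p (Suc l)) = j" using Suc.prems edge(5)[of l] by simp
    ultimately show ?case by (cases "even l") auto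
  qed
  have "odd m" using cols[of m] p(2) ij by (metis order_refl)
  moreover have "m \<noteq> 1" using edge(3)[of 0] p(1,2) nadj by auto
  ultimately have "3 \<le> m" using m0 by presburger
  have lt: "p l \<sim> p l' \<longleftrightarrow> l' = Suc l" if "l < l'" "l' \<le> m" for l l'
  proof
    assume "p l \<sim> p l'"
    moreover have "c (p l) \<in> {i, j}" "c (p l') \<in> {i, j}" using cols that by auto
    ultimately have "(p l, p l') \<in> bichromatic S c i j"
      unfolding bichromatic_def using inS that by auto
    then show "l' = Suc l" using p(5) that by blast
  next
    assume "l' = Suc l"
    then show "p l \<sim> p l'" using edge(3) that by simp
  qed
  have "p l \<sim> p l' \<longleftrightarrow> l' = Suc l \<or> l = Suc l'" if "l \<le> m" "l' \<le> m" for l l'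
  proof (cases l l' rule: linorder_cases)
    case less
    then show ?thesis using lt[of l l'] that by auto
  next
    case equal
    then show ?thesis using adj_irrefl by auto
  next
    case greater
    then show ?thesis using lt[of l' l] that adj_commute[of "p l" "p l'"] by auto
  qed
  then show ?thesis using that[OF p(1,2) \<open>odd m\<close> \<open>3 \<le> m\<close> p(3)] inS cols by blast
qed

text \<open>The path has \<open>m + 1\<close> vertices, so together with \<open>x\<close> it forms a
  cycle of odd length \<open>m + 2\<close>, at least 5.\<close>

lemma odd_hole_close_path:
  assumes m: "odd m" "3 \<le> m" and inj: "inj_on p {..m}"
    and path: "\<And>l l'. l \<le> m \<Longrightarrow> l' \<le> m \<Longrightarrow> p l \<sim> p l' \<longleftrightarrow> l' = Suc l \<or> l = Suc l'"
    and S: "x \<in> S" "\<And>l. l \<le> m \<Longrightarrow> p l \<in> S"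
    and x: "\<And>l. l \<le> m \<Longrightarrow> x \<noteq> p l" "\<And>l. l \<le> m \<Longrightarrow> x \<sim> p l \<longleftrightarrow> l = 0 \<or> l = m"
  shows "odd_hole_in S"
proof -
  define h where "h i = (case i of 0 \<Rightarrow> x | Suc l \<Rightarrow> p l)" for i
  let ?n = "m + 2"
  have h0: "h 0 = x" and hS: "h (Suc l) = p l" for l by (simp_all add: h_def)
  have "inj_on h {..<?n}"
  proof (rule inj_onI)
    fix i j assume "i \<in> {..<?n}" "j \<in> {..<?n}" "h i = h j"
    then show "i = j"
      using x(1) not_sym[OF x(1)] inj by (cases i; cases j) (auto simp: h0 hS inj_on_def)
  qed
  moreover have "h i \<sim> h j \<longleftrightarrow> j = Suc i mod ?n \<or> i = Suc j mod ?n"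
    if ij: "i < ?n" "j < ?n" for i j
  proof -
    have sm: "Suc l mod ?n = (if l = Suc m then 0 else Suc l)" if "l < ?n" for l
      using that by auto
    show ?thesis
      using x(2) path adj_irrefl ij adj_commute[of "h i" "h j"] m(2) unfolding sm[OF ij(1)] sm[OF ij(2)]
      by (cases i; cases j) (auto simp: h0 hS)
  qed
  ultimately have "hole ?n h" unfolding hole_def by blast
  moreover have "h ` {..<?n} \<subseteq> S"
  proof
    fix y assume "y \<in> h ` {..<?n}"
    then obtain i where "i < ?n" "y = h i" by blast
    then show "y \<in> S" using S by (cases i) (auto simp: h0 hS)
  qed
  ultimately show ?thesis using m unfolding odd_hole_in_def by (intro exI[of _ ?n] exI[of _ h]) auto
qed

definition kempe_swap :: "'a set \<Rightarrow> ('a \<Rightarrow> nat) \<Rightarrow> nat \<Rightarrow> nat \<Rightarrow> 'a \<Rightarrow> 'a \<Rightarrow> nat" where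
  "kempe_swap S c i j a v =
    (if (a, v) \<in> (bichromatic S c i j)\<^sup>* then (if c v = i then j else i) else c v)"

lemma bichromatic_reachable_colour:
  assumes "(a, v) \<in> (bichromatic S c i j)\<^sup>*" "c a \<in> {i, j}"
  shows "c v \<in> {i, j}"
  using assms by (induction rule: rtrancl_induct) (auto simp: bichromatic_def)

text \<open>By reflexivity \<open>a\<close> lies in its own chain and is recoloured whatever its
  colour is; hence the assumption on \<open>c a\<close>.\<close>

lemma kempe_swap_colouring:
  assumes col: "colouring S k c" and ij: "i < k" "j < k" "i \<noteq> j" and a: "c a \<in> {i, j}"
  shows "colouring S k (kempe_swap S c i j a)"
proof (rule colouringI)
  fix v assume "v \<in> S"
  then show "kempe_swap S c i j a v < k"
    using colouring_less[OF col] ij unfolding kempe_swap_def by auto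
next
  fix u v assume uv: "u \<in> S" "v \<in> S" "u \<sim> v"
  let ?R = "bichromatic S c i j"
  have neq: "c u \<noteq> c v" using colouring_neq[OF col uv] .
  have step: "(a, w') \<in> ?R\<^sup>*"
    if "(a, w) \<in> ?R\<^sup>*" "w \<in> S" "w' \<in> S" "w \<sim> w'" "c w' \<in> {i, j}" for w w'
  proof -
    have "(w, w') \<in> ?R"
      using that bichromatic_reachable_colour[OF that(1) a] unfolding bichromatic_def by blast
    then show ?thesis using that(1) by (rule rtrancl_into_rtrancl[rotated])
  qed
  show "kempe_swap S c i j a u \<noteq> kempe_swap S c i j a v"
    using neq step[of u v] step[of v u] uv adj_sym[of u v] ij(3)
      bichromatic_reachable_colour[of a u S c i j] bichromatic_reachable_colour[of a v S c i j] a
    unfolding kempe_swap_def by auto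
qed

end

text \<open>
  Here \<open>X\<close> is the set of neighbours in \<open>D\<close> of a vertex outside \<open>D\<close>, from
  which the fork behind \<open>fork_nbrs\<close> is completed. The assumptions on \<open>D\<close> and \<open>k\<close> are contradictory as soon as \<open>D\<close> minus some
  vertex of \<open>X\<close> is \<open>k\<close>-colourable.
\<close>

locale kempe = adjacency +
  fixes D X :: "'a set" and k :: nat
  assumes finite_D: "finite D" and X_D: "X \<subseteq> D" and cliq_X: "cliq X"
    and cliq_nbrs: "\<And>x. x \<in> X \<Longrightarrow> cliq {y \<in> D - X. x \<sim> y}"
    and fork_nbrs: "\<And>x y y1 y2. x \<in> X \<Longrightarrow> y \<in> D - X \<Longrightarrow> y1 \<in> D - X \<Longrightarrow> y2 \<in> D - X \<Longrightarrow>
      y \<sim> x \<Longrightarrow> y \<sim> y1 \<Longrightarrow> y \<sim> y2 \<Longrightarrow> y1 \<noteq> y2 \<Longrightarrow> x \<sim> y1 \<or> x \<sim> y2 \<or> y1 \<sim> y2"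
    and no_odd_hole: "\<not> odd_hole_in D"
    and om_le: "om D \<le> k"
    and not_colouring: "\<And>c. \<not> colouring D k c"
begin

section \<open>Colourings that miss one vertex of \<open>X\<close>\<close>

definition nbrs :: "'a \<Rightarrow> 'a set" where
  "nbrs x = {y \<in> D - X. x \<sim> y}"

definition near_colouring :: "('a \<Rightarrow> nat) \<Rightarrow> 'a \<Rightarrow> bool" where
  "near_colouring c z \<longleftrightarrow> z \<in> X \<and> colouring (D - {z}) k c"

lemma near_colouring_X_inj:
  assumes "near_colouring c z" "a \<in> X" "a \<noteq> z" "b \<in> X" "b \<noteq> z" "c a = c b"
  shows "a = b"
proof (rule ccontr)
  assume "a \<noteq> b"
  then have "a \<sim> b" using cliqD[OF cliq_X] assms by blast
  then show False using colouring_neq[of "D - {z}" k c a b] assms X_D unfolding near_colouring_def by blast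
qed

lemma near_colouring_nbrs_inj:
  assumes "near_colouring c z" "x \<in> X" "y \<in> nbrs x" "y' \<in> nbrs x" "c y = c y'"
  shows "y = y'"
proof (rule ccontr)
  assume "y \<noteq> y'"
  then have "y \<sim> y'" using cliqD[OF cliq_nbrs[OF assms(2)]] assms unfolding nbrs_def by blast
  moreover have "y \<in> D - {z}" "y' \<in> D - {z}"
    using assms unfolding nbrs_def near_colouring_def by blast+
  ultimately show False using colouring_neq[of "D - {z}" k c y y'] assms unfolding near_colouring_def by blast
qed

lemma nbr_cases:
  assumes "x \<in> X" "y \<in> D" "x \<sim> y"
  shows "y \<in> X \<or> y \<in> nbrs x"
  using assms unfolding nbrs_def by blast

text \<open>A colour seen nowhere around \<open>z\<close> could be given to \<open>z\<close>, which
  would colour all of \<open>D\<close>.\<close>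

lemma near_colouring_colour_blocked:
  assumes st: "near_colouring c z" and i: "i < k" "i \<notin> c ` nbrs z"
  shows "i \<in> c ` (X - {z})"
proof (rule ccontr)
  assume nX: "i \<notin> c ` (X - {z})"
  have z: "z \<in> X" and col: "colouring (D - {z}) k c" using st unfolding near_colouring_def by blast+
  have free: "c y \<noteq> i" if "y \<in> D" "z \<sim> y" for y
    using nbr_cases[OF z that] nX i(2) that adj_irrefl by blast
  have "colouring D k (c(z := i))"
  proof (rule colouringI)
    fix v assume "v \<in> D"
    then show "(c(z := i)) v < k" using i(1) colouring_less[OF col, of v] by auto
  next
    fix u v assume "u \<in> D" "v \<in> D" "u \<sim> v"
    then show "(c(z := i)) u \<noteq> (c(z := i)) v"
      using free[of u] free[of v] adj_sym[of u v] adj_irrefl colouring_neq[OF col, of u v] by auto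
  qed
  then show False using not_colouring by blast
qed

text \<open>The colours of \<open>a\<close> and \<open>b\<close> each occur just once around
  \<open>z\<close>. Without the edge, their chain from \<open>a\<close> either reaches
  \<open>b\<close> and closes through \<open>z\<close> to an odd hole, or can be swapped, which
  frees the colour of \<open>a\<close> for \<open>z\<close>.\<close>

lemma near_colouring_adjacent:
  assumes st: "near_colouring c z" and a: "a \<in> X" "a \<noteq> z" "c a \<notin> c ` nbrs z"
    and b: "b \<in> nbrs z" "c b \<notin> c ` (X - {z})"
  shows "a \<sim> b"
proof (rule ccontr)
  assume nadj: "\<not> a \<sim> b"
  have z: "z \<in> X" and col: "colouring (D - {z}) k c" using st unfolding near_colouring_def by blast+
  have D: "a \<in> D - {z}" "b \<in> D - {z}" using a b(1) X_D z unfolding nbrs_def by blast+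
  have ne: "c a \<noteq> c b" using a(3) b(1) by auto
  have za: "z \<sim> a" using cliqD[OF cliq_X z a(1)] a(2) by blast
  have zb: "z \<sim> b" using b(1) unfolding nbrs_def by blast
  have col_a: "y = a" if "y \<in> D - {z}" "z \<sim> y" "c y = c a" for y
  proof -
    have "y \<notin> nbrs z" using a(3) that(3) by (metis imageI)
    then have "y \<in> X" using nbr_cases[OF z] that by blast
    then show ?thesis using near_colouring_X_inj[OF st] a that by blast
  qed
  have col_b: "y = b" if "y \<in> D - {z}" "z \<sim> y" "c y = c b" for y
  proof -
    have "y \<notin> X" using b(2) that by (metis DiffD2 DiffI imageI)
    then have "y \<in> nbrs z" using nbr_cases[OF z] that by blast
    then show ?thesis using near_colouring_nbrs_inj[OF st z _ b(1)] that by blast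
  qed
  let ?R = "bichromatic (D - {z}) c (c a) (c b)"
  show False
  proof (cases "(a, b) \<in> ?R\<^sup>*")
    case True
    obtain p m where path: "p 0 = a" "p m = b" "odd m" "3 \<le> m" "inj_on p {..m}"
      "\<forall>l\<le>m. p l \<in> D - {z}" "\<forall>l\<le>m. c (p l) = (if even l then c a else c b)"
      "\<forall>l\<le>m. \<forall>l'\<le>m. p l \<sim> p l' \<longleftrightarrow> l' = Suc l \<or> l = Suc l'"
      using bichromatic_path[OF col True refl refl ne nadj] by blast
    note p = path[rule_format]
    have "l = 0 \<or> l = m" if "l \<le> m" "z \<sim> p l" for l
    proof -
      have "p l = p 0 \<or> p l = p m"
        using col_a[OF p(6)[OF that(1)] that(2)] col_b[OF p(6)[OF that(1)] that(2)]
          p(7)[OF that(1)] p(1,2) by (metis (full_types))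
      then show ?thesis using inj_onD[OF p(5)] that(1) by (metis atMost_iff le0 order_refl)
    qed
    then have zp: "z \<sim> p l \<longleftrightarrow> l = 0 \<or> l = m" if "l \<le> m" for l
      using that za zb p(1,2) by auto
    have "odd_hole_in D"
      by (rule odd_hole_close_path[OF p(3,4,5,8), of z]) (use p(6) zp z X_D in auto)
    then show False using no_odd_hole by blast
  next
    case False
    let ?c = "kempe_swap (D - {z}) c (c a) (c b) a"
    have "colouring (D - {z}) k ?c"
      using colouring_less[OF col] D by (intro kempe_swap_colouring[OF col _ _ ne]) auto
    then have st': "near_colouring ?c z" using z unfolding near_colouring_def by blast
    have avoid: "?c y \<noteq> c a" if y: "y \<in> D - {z}" "z \<sim> y" for y
    proof
      assume eq: "?c y = c a"
      show False
      proof (cases "(a, y) \<in> ?R\<^sup>*")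
        case True
        then have "c y \<in> {c a, c b}" using bichromatic_reachable_colour by blast
        moreover have "c y \<noteq> c a" using eq True ne unfolding kempe_swap_def by auto
        ultimately have "y = b" using col_b[OF y] by blast
        then show False using True False by blast
      next
        case nreach: False
        then have "c y = c a" using eq unfolding kempe_swap_def by simp
        then have "y = a" using col_a[OF y] by blast
        then show False using nreach by blast
      qed
    qed
    have "?c y \<noteq> c a" if "y \<in> nbrs z" for y
      using avoid[of y] that z unfolding nbrs_def by auto
    moreover have "?c y \<noteq> c a" if "y \<in> X - {z}" for y
      using avoid[of y] that X_D cliqD[OF cliq_X z, of y] by auto
    ultimately have "c a \<notin> ?c ` nbrs z" "c a \<notin> ?c ` (X - {z})"
      by (metis imageE)+
    then show False
      using near_colouring_colour_blocked[OF st', of "c a"] colouring_less[OF col D(1)] by blast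
  qed
qed

text \<open>The colour of \<open>q\<close> occurs twice around \<open>z\<close>, so a path from
  \<open>q\<close> to \<open>b\<close> may run through \<open>y\<close>, and then \<open>z\<close>
  does not close it to a hole; in that case \<open>a\<close> does. If the chain of \<open>q\<close>
  misses \<open>b\<close>, swapping it takes the colour of \<open>y\<close> away from
  \<open>X - {z}\<close>, and \<open>near_colouring_adjacent\<close> applies to \<open>a\<close> and
  \<open>y\<close>.\<close>

lemma near_colouring_adjacent_or:
  assumes st: "near_colouring c z" and a: "a \<in> X" "a \<noteq> z" "c a \<notin> c ` nbrs z"
    and b: "b \<in> nbrs z" "c b \<notin> c ` (X - {z})"
    and q: "q \<in> X" "q \<noteq> z" and y: "y \<in> nbrs z" "c q = c y"
  shows "q \<sim> b \<or> a \<sim> y"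
proof (rule ccontr)
  assume nadj: "\<not> (q \<sim> b \<or> a \<sim> y)"
  then have qb: "\<not> q \<sim> b" and ay: "\<not> a \<sim> y" by blast+
  have z: "z \<in> X" and col: "colouring (D - {z}) k c" using st unfolding near_colouring_def by blast+
  have D: "a \<in> D - {z}" "b \<in> D - {z}" "q \<in> D - {z}" "y \<in> D - {z}"
    using a b(1) q y(1) X_D z unfolding nbrs_def by blast+
  have ab: "a \<sim> b" using near_colouring_adjacent[OF st a b] .
  have ne: "c q \<noteq> c b" using b(2) q by (metis DiffI imageI singletonD)
  have ne_a: "c a \<noteq> c q" "c a \<noteq> c b" using a(3) b(1) y by auto
  have zq: "z \<sim> q" using cliqD[OF cliq_X z q(1)] q(2) by blast
  have aq: "a \<sim> q" using cliqD[OF cliq_X a(1) q(1)] ne_a by blast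
  have zb: "z \<sim> b" using b(1) unfolding nbrs_def by blast
  have yb: "y \<sim> b" using cliqD[OF cliq_nbrs[OF z]] b(1) y ne unfolding nbrs_def by metis
  have b_a: "b \<in> nbrs a" using b(1) ab unfolding nbrs_def by blast
  have X_q: "v = q" if "v \<in> X" "v \<noteq> z" "c v = c q" for v
    using near_colouring_X_inj[OF st] q that by blast
  have not_X: "v \<notin> X" if "v \<noteq> z" "c v = c b" for v
    using b(2) that by (metis DiffI imageI singletonD)
  let ?R = "bichromatic (D - {z}) c (c q) (c b)"
  show False
  proof (cases "(q, b) \<in> ?R\<^sup>*")
    case True
    obtain p m where path: "p 0 = q" "p m = b" "odd m" "3 \<le> m" "inj_on p {..m}"
      "\<forall>l\<le>m. p l \<in> D - {z}" "\<forall>l\<le>m. c (p l) = (if even l then c q else c b)"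
      "\<forall>l\<le>m. \<forall>l'\<le>m. p l \<sim> p l' \<longleftrightarrow> l' = Suc l \<or> l = Suc l'"
      using bichromatic_path[OF col True refl refl ne qb] by blast
    note p = path[rule_format]
    have ends: "l = 0 \<or> l = m" if "l \<le> m" "p l = q \<or> p l = b" for l
      using that inj_onD[OF p(5), of l 0] inj_onD[OF p(5), of l m] p(1,2) by auto
    show False
    proof (cases "y \<in> p ` {..m}")
      case False
      have "l = 0 \<or> l = m" if "l \<le> m" "z \<sim> p l" for l
      proof (cases "even l")
        case True
        then have cl: "c (p l) = c q" using p(7)[OF that(1)] by simp
        then have "p l \<notin> nbrs z"
          using near_colouring_nbrs_inj[OF st z _ y(1), of "p l"] y(2) False that(1)
          by (metis atMost_iff imageI)
        then have "p l \<in> X" using nbr_cases[OF z] that p(6) by blast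
        then show ?thesis using X_q[of "p l"] cl p(6) that(1) ends by blast
      next
        case False
        then have cl: "c (p l) = c b" using p(7)[OF that(1)] by simp
        then have "p l \<notin> X" using not_X p(6) that(1) by blast
        then have "p l \<in> nbrs z" using nbr_cases[OF z] that p(6) by blast
        then show ?thesis using near_colouring_nbrs_inj[OF st z _ b(1)] cl ends that(1) by blast
      qed
      then have zp: "z \<sim> p l \<longleftrightarrow> l = 0 \<or> l = m" if "l \<le> m" for l
        using that zq zb p(1,2) by auto
      have "odd_hole_in D"
        by (rule odd_hole_close_path[OF p(3,4,5,8), of z]) (use p(6) zp z X_D in auto)
      then show False using no_odd_hole by blast
    next
      case True
      \<comment> \<open>On an induced path only the vertex before the end \<open>b\<close> is
        adjacent to \<open>b\<close>, and \<open>y\<close> is adjacent to \<open>b\<close>.\<close>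
      have pred: "p l = y" if l: "l \<le> m" "p l \<sim> b" for l
      proof -
        obtain l' where l': "l' \<le> m" "y = p l'" using True by blast
        have "m = Suc l" "m = Suc l'"
          using p(8)[of l m] p(8)[of l' m] l l' yb p(2) by auto
        then show ?thesis using l' by simp
      qed
      have "l = 0 \<or> l = m" if "l \<le> m" "a \<sim> p l" for l
      proof (cases "even l")
        case True
        then have cl: "c (p l) = c q" using p(7)[OF that(1)] by simp
        have "p l \<notin> nbrs a"
        proof
          assume "p l \<in> nbrs a"
          then have "p l \<sim> b"
            using cliqD[OF cliq_nbrs[OF a(1)]] b_a cl ne unfolding nbrs_def by metis
          then show False using pred that ay by blast
        qed
        then have "p l \<in> X" using nbr_cases[OF a(1)] that p(6) by blast
        then show ?thesis using X_q[of "p l"] cl p(6) that(1) ends by blast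
      next
        case False
        then have cl: "c (p l) = c b" using p(7)[OF that(1)] by simp
        then have "p l \<notin> X" using not_X p(6) that(1) by blast
        then have "p l \<in> nbrs a" using nbr_cases[OF a(1)] that p(6) by blast
        then show ?thesis using near_colouring_nbrs_inj[OF st a(1) _ b_a] cl ends that(1) by blast
      qed
      then have ap: "a \<sim> p l \<longleftrightarrow> l = 0 \<or> l = m" if "l \<le> m" for l
        using that aq ab p(1,2) by auto
      have "a \<noteq> p l" if "l \<le> m" for l
        using p(7)[OF that] ne_a by (metis (full_types))
      then have "odd_hole_in D"
        by (intro odd_hole_close_path[OF p(3,4,5,8), of a]) (use p(6) ap D(1) in auto)
      then show False using no_odd_hole by blast
    qed
  next
    case False
    let ?c = "kempe_swap (D - {z}) c (c q) (c b) q"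
    have "colouring (D - {z}) k ?c"
      using colouring_less[OF col] D by (intro kempe_swap_colouring[OF col _ _ ne]) auto
    then have st': "near_colouring ?c z" using z unfolding near_colouring_def by blast
    have reach_col: "c v \<in> {c q, c b}" if "(q, v) \<in> ?R\<^sup>*" for v
      using bichromatic_reachable_colour[OF that] by blast
    \<comment> \<open>The edge from \<open>y\<close> to \<open>b\<close> puts them into one chain,
      which \<open>q\<close> does not reach. So \<open>y\<close> keeps its colour under the
      swap.\<close>
    have "(q, y) \<notin> ?R\<^sup>*"
    proof
      assume "(q, y) \<in> ?R\<^sup>*"
      moreover have "(y, b) \<in> ?R" using D yb y(2) unfolding bichromatic_def by auto
      ultimately show False using False by (meson rtrancl_into_rtrancl)
    qed
    then have cy: "?c y = c q" using y(2) unfolding kempe_swap_def by simp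
    have "(q, a) \<notin> ?R\<^sup>*" using reach_col[of a] ne_a by blast
    then have ca: "?c a = c a" unfolding kempe_swap_def by simp
    have "?c v \<noteq> c a" if "v \<in> nbrs z" for v
      using imageI[OF that, of c] a(3) ne_a reach_col[of v] unfolding kempe_swap_def by auto
    then have 1: "?c a \<notin> ?c ` nbrs z" using ca by force
    have "?c v \<noteq> c q" if v: "v \<in> X" "v \<noteq> z" for v
    proof (cases "(q, v) \<in> ?R\<^sup>*")
      case True
      then show ?thesis using not_X[of v] v reach_col[of v] ne unfolding kempe_swap_def by auto
    next
      case False
      then show ?thesis using X_q[OF v] unfolding kempe_swap_def by auto
    qed
    then have 2: "?c y \<notin> ?c ` (X - {z})" using cy by force
    show False using near_colouring_adjacent[OF st' a(1,2) 1 y(1) 2] ay by blast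
  qed
qed

text \<open>It suffices that \<open>a\<close> is adjacent to \<open>y\<close>, because colours do
  not repeat on \<open>nbrs a\<close>. This follows from \<open>near_colouring_adjacent\<close>
  unless some \<open>q\<close> in \<open>X\<close> has the colour of \<open>y\<close>; then
  \<open>near_colouring_adjacent_or\<close> leaves only an alternative that contradicts
  \<open>fork_nbrs\<close>.\<close>

lemma near_colouring_common_nbr:
  assumes st: "near_colouring c z" and a: "a \<in> X" "a \<noteq> z" "c a \<notin> c ` nbrs z"
    and y: "y \<in> nbrs z" "y' \<in> nbrs a" "c y = c y'"
  shows "y = y'"
proof -
  have z: "z \<in> X" and col: "colouring (D - {z}) k c" using st unfolding near_colouring_def by blast+
  have common: "y = y'" if "a \<sim> y"
    using near_colouring_nbrs_inj[OF st a(1) _ y(2)] that y unfolding nbrs_def by blast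
  show ?thesis
  proof (cases "c y \<in> c ` (X - {z})")
    case False
    then show ?thesis using common near_colouring_adjacent[OF st a y(1)] by blast
  next
    case True
    then obtain q where "q \<in> X - {z}" "c y = c q" by (rule imageE) simp
    then have q: "q \<in> X" "q \<noteq> z" "c q = c y" by simp_all
    \<comment> \<open>As \<open>X\<close> has at most \<open>k\<close> vertices and \<open>z\<close>
      is uncoloured, some colour is missing on \<open>X - {z}\<close>; it is the colour of
      \<open>b\<close> below.\<close>
    have "card (X - {z}) < k"
    proof -
      have "card X \<le> k" using card_le_om[OF finite_D X_D cliq_X] om_le by simp
      moreover have "finite X" using finite_D X_D finite_subset by blast
      ultimately show ?thesis using z by (metis card_Diff1_less order_less_le_trans)
    qed
    then have "card (c ` (X - {z})) < card {..<k}"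
      using card_image_le[of "X - {z}" c] finite_D X_D by (simp add: finite_subset)
    then have "\<not> {..<k} \<subseteq> c ` (X - {z})"
      using card_mono[of "c ` (X - {z})" "{..<k}"] finite_D X_D by (meson finite_Diff finite_imageI
          finite_subset leD)
    then obtain j where j: "j < k" "j \<notin> c ` (X - {z})" by blast
    then obtain b where b: "b \<in> nbrs z" "c b \<notin> c ` (X - {z})"
      using near_colouring_colour_blocked[OF st, of j] by blast
    have ab: "b \<in> nbrs a"
      using near_colouring_adjacent[OF st a b] b(1) unfolding nbrs_def by blast
    have "q \<sim> b \<or> a \<sim> y" using near_colouring_adjacent_or[OF st a b q(1,2) y(1) q(3)] .
    then show ?thesis
    proof
      assume "q \<sim> b"
      show ?thesis
      proof (rule ccontr)
        assume "y \<noteq> y'"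
        have ne: "c b \<noteq> c y" using b(2) True by metis
        have Y: "b \<in> D - X" "y \<in> D - X" "y' \<in> D - X"
          using b(1) y unfolding nbrs_def by blast+
        have "b \<sim> y"
          using cliqD[OF cliq_nbrs[OF z], of b y] b(1) y(1) ne unfolding nbrs_def by auto
        moreover have "b \<sim> y'"
          using cliqD[OF cliq_nbrs[OF a(1)], of b y'] ab y(2,3) ne unfolding nbrs_def by auto
        \<comment> \<open>Equal colours keep \<open>q\<close>, \<open>y\<close>, \<open>y'\<close>
          pairwise nonadjacent, so \<open>b\<close> would be the centre of a claw with these
          leaves.\<close>
        ultimately have "q \<sim> y \<or> q \<sim> y' \<or> y \<sim> y'"
          using fork_nbrs[OF q(1) Y adj_sym[OF \<open>q \<sim> b\<close>]] \<open>y \<noteq> y'\<close> by blast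
        moreover have D: "q \<in> D - {z}" "y \<in> D - {z}" "y' \<in> D - {z}"
          using q Y z X_D by blast+
        ultimately show False
          using colouring_neq[OF col D(1,2)] colouring_neq[OF col D(1,3)] colouring_neq[OF col D(2,3)]
            q(3) y(3) by metis
      qed
    next
      assume "a \<sim> y"
      then show ?thesis using common by blast
    qed
  qed
qed

text \<open>
  The uncoloured vertex \<open>z\<close> may take the colour of \<open>a\<close>, which leaves \<open>a\<close> uncoloured.
\<close>

inductive shifted :: "('a \<Rightarrow> nat) \<Rightarrow> 'a \<Rightarrow> ('a \<Rightarrow> nat) \<Rightarrow> 'a \<Rightarrow> bool" for c x where
  start: "shifted c x c x"
| shift: "shifted c x c' z \<Longrightarrow> a \<in> X \<Longrightarrow> a \<noteq> z \<Longrightarrow> c' a \<notin> c' ` nbrs z \<Longrightarrow>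
    shifted c x (c'(z := c' a)) a"

text \<open>Around \<open>z\<close> the colour of \<open>a\<close> occurs at \<open>a\<close> alone,
  which gives it up. Only vertices of \<open>X\<close> change colour, so the colours on every
  \<open>nbrs z\<close> can still be read off from the original \<open>c\<close>.\<close>

lemma shifted_near_colouring:
  assumes "shifted c x c' z" "near_colouring c x"
  shows "near_colouring c' z \<and> (\<forall>y\<in>D - X. c' y = c y)"
  using assms
proof (induction rule: shifted.induct)
  case start
  then show ?case by blast
next
  case (shift c' z a)
  then have st: "near_colouring c' z" and eq: "\<forall>y\<in>D - X. c' y = c y" by blast+
  have z: "z \<in> X" and col: "colouring (D - {z}) k c'" using st unfolding near_colouring_def by blast+
  have aD: "a \<in> D - {z}" using shift.hyps X_D by blast
  have free: "c' y \<noteq> c' a" if "y \<in> D" "y \<noteq> a" "z \<sim> y" for y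
  proof -
    have "y \<noteq> z" using that adj_irrefl by blast
    moreover have "y \<in> nbrs z \<Longrightarrow> ?thesis" using shift.hyps(4) by (metis imageI)
    ultimately show ?thesis
      using nbr_cases[OF z that(1,3)] near_colouring_X_inj[OF st, of y a] shift.hyps that by auto
  qed
  have "colouring (D - {a}) k (c'(z := c' a))"
  proof (rule colouringI)
    fix v assume "v \<in> D - {a}"
    then show "(c'(z := c' a)) v < k"
      using colouring_less[OF col, of v] colouring_less[OF col aD] by auto
  next
    fix u v assume "u \<in> D - {a}" "v \<in> D - {a}" "u \<sim> v"
    then show "(c'(z := c' a)) u \<noteq> (c'(z := c' a)) v"
      using free[of u] free[of v] adj_sym[of u v] adj_irrefl colouring_neq[OF col, of u v] by auto
  qed
  then show ?case using eq z shift.hyps unfolding near_colouring_def by auto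
qed

text \<open>
  Let \<open>Z\<close> be the set of vertices that can be made uncoloured by shifts and \<open>P\<close> the set of colours
  used on \<open>Z\<close> minus the uncoloured vertex. Each colour outside \<open>P\<close> occurs on one common neighbour
  of all of \<open>Z\<close>; together with \<open>Z\<close>, these neighbours form a clique with more than \<open>k\<close> vertices.
\<close>

lemma no_near_colouring: "\<not> near_colouring c x"
proof
  assume st0: "near_colouring c x"
  define Z where "Z = {z. \<exists>c'. shifted c x c' z}"
  define P where "P = c ` (Z - {x})"
  have x_Z: "x \<in> Z" unfolding Z_def using shifted.start by blast
  have Z_X: "Z \<subseteq> X"
    using shifted_near_colouring st0 unfolding Z_def near_colouring_def by blast
  have fin: "finite X" "finite Z"
    using finite_subset[OF X_D finite_D] finite_subset[OF Z_X] by blast+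
  have col: "colouring (D - {x}) k c" using st0 unfolding near_colouring_def by blast
  \<comment> \<open>A shift hands the colour of \<open>a\<close> to \<open>z\<close>, and both
    vertices belong to \<open>Z\<close>.\<close>
  have cols: "c' ` (Z - {z}) = P" if "shifted c x c' z" for c' z
    using that
  proof (induction rule: shifted.induct)
    case start
    then show ?case by (simp add: P_def)
  next
    case (shift c' z a)
    have "z \<in> Z" "a \<in> Z" using shift.hyps shifted.shift unfolding Z_def by blast+
    then have "Z - {a} = insert z (Z - {z, a})" "Z - {z} = insert a (Z - {z, a})"
      using shift.hyps by blast+
    moreover have "(c'(z := c' a)) ` (Z - {z, a}) = c' ` (Z - {z, a})"
      by (rule image_cong) auto
    ultimately have "(c'(z := c' a)) ` (Z - {a}) = c' ` (Z - {z})"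
      by (metis fun_upd_same image_insert)
    then show ?case using shift.IH by simp
  qed
  \<comment> \<open>If \<open>i\<close> were missing on \<open>nbrs z\<close>, some \<open>a\<close>
    in \<open>X\<close> would carry it, a shift would bring \<open>a\<close> into \<open>Z\<close>,
    and \<open>i\<close> would lie in \<open>P\<close>.\<close>
  have blocked: "\<exists>y\<in>nbrs z. c y = i" if z: "z \<in> Z" and i: "i < k" "i \<notin> P" for z i
  proof (rule ccontr)
    assume neg: "\<not> ?thesis"
    obtain c' where c': "shifted c x c' z" using z by (auto simp: Z_def)
    have st: "near_colouring c' z" and eq: "\<forall>y\<in>D - X. c' y = c y"
      using shifted_near_colouring[OF c' st0] by blast+
    have *: "i \<notin> c' ` nbrs z" using neg eq unfolding nbrs_def by force
    then obtain a where a: "a \<in> X" "a \<noteq> z" "c' a = i"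
      using near_colouring_colour_blocked[OF st i(1)] by auto
    then have "a \<in> Z" using shifted.shift[OF c'] * unfolding Z_def by blast
    then have "i \<in> c' ` (Z - {z})" using a by blast
    then show False using cols[OF c'] i(2) by blast
  qed
  then have "\<forall>i\<in>{..<k} - P. \<exists>y. y \<in> nbrs x \<and> c y = i" using x_Z by blast
  then obtain f where f: "\<And>i. i \<in> {..<k} - P \<Longrightarrow> f i \<in> nbrs x \<and> c (f i) = i" by metis
  \<comment> \<open>By \<open>near_colouring_common_nbr\<close>, the neighbours chosen for
    \<open>x\<close> remain neighbours along all shifts.\<close>
  have f_nbrs: "f i \<in> nbrs z" if zi: "z \<in> Z" "i \<in> {..<k} - P" for z i
  proof -
    obtain c' where "shifted c x c' z" using zi(1) by (auto simp: Z_def)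
    then show ?thesis
    proof (induction rule: shifted.induct)
      case start
      then show ?case using f zi(2) by blast
    next
      case (shift c' z a)
      have st: "near_colouring c' z" and eq: "\<forall>y\<in>D - X. c' y = c y"
        using shifted_near_colouring[OF shift.hyps(1) st0] by blast+
      have "a \<in> Z" using shifted.shift[OF shift.hyps] unfolding Z_def by blast
      then obtain y' where y': "y' \<in> nbrs a" "c y' = i" using blocked zi(2) by blast
      have "c' (f i) = c' y'"
        using eq y' f[OF zi(2)] shift.IH unfolding nbrs_def by auto
      then have "f i = y'"
        using near_colouring_common_nbr[OF st shift.hyps(2,3,4) shift.IH y'(1)] by blast
      then show ?case using y' by blast
    qed
  qed
  let ?F = "f ` ({..<k} - P)"
  have FX: "?F \<inter> X = {}" and FD: "?F \<subseteq> D" using f unfolding nbrs_def by blast+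
  have "cliq (Z \<union> ?F)"
  proof (rule cliq_Un)
    show "cliq Z" using cliq_subset[OF cliq_X Z_X] .
    show "cliq ?F"
      using cliq_subset[OF cliq_nbrs[of x]] f Z_X x_Z unfolding nbrs_def
      by (metis (no_types, lifting) image_subsetI subsetD)
    show "u \<sim> v" if "u \<in> Z" "v \<in> ?F" for u v
      using that f_nbrs unfolding nbrs_def by blast
  qed
  moreover have "Z \<union> ?F \<subseteq> D" using FD Z_X X_D by blast
  ultimately have "card (Z \<union> ?F) \<le> k"
    using card_le_om[OF finite_D, of "Z \<union> ?F"] om_le by (meson le_trans)
  moreover have "card (Z \<union> ?F) = card Z + card ?F"
    by (rule card_Un_disjoint) (use fin FX Z_X in auto)
  moreover have "card ?F = card ({..<k} - P)"
    by (rule card_image) (metis f inj_onI)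
  moreover have "card ({..<k} - P) \<ge> k - card P"
    using diff_card_le_card_Diff[of P "{..<k}"] fin unfolding P_def by auto
  \<comment> \<open>The vertex \<open>x\<close> contributes no colour to \<open>P\<close>; this
    surplus of one takes the clique beyond \<open>k\<close>.\<close>
  moreover have "card P < card Z"
    using card_image_le[of "Z - {x}" c] fin(2) x_Z card_Diff1_less[of Z x] unfolding P_def by auto
  moreover have "card P \<le> k"
  proof -
    have "P \<subseteq> {..<k}" using colouring_less[OF col] Z_X X_D unfolding P_def by auto
    then show ?thesis using card_mono[of "{..<k}" P] by simp
  qed
  ultimately show False by linarith
qed

end

section \<open>Neighbourhoods at distance two from a hole\<close>

text \<open>
  The fork has centre \<open>a\<close>, leaves \<open>b\<close> and \<open>c\<close>, and the long branch \<open>d\<close>, \<open>e\<close>; all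
  distinctness conditions other than \<open>b \<noteq> c\<close> follow from the adjacencies.
\<close>

locale fork_free = adjacency +
  fixes V :: "'a set"
  assumes finite_V: "finite V"
    and no_fork: "\<And>a b c d e. {a, b, c, d, e} \<subseteq> V \<Longrightarrow> a \<sim> b \<Longrightarrow> a \<sim> c \<Longrightarrow> a \<sim> d \<Longrightarrow> d \<sim> e \<Longrightarrow>
      b \<noteq> c \<Longrightarrow> b \<sim> c \<or> b \<sim> d \<or> b \<sim> e \<or> c \<sim> d \<or> c \<sim> e \<or> a \<sim> e"

text \<open>
  \<open>C\<close> is an induced cycle with at least five vertices, traversed by \<open>nx\<close>.
\<close>

locale fork_free_cycle = fork_free +
  fixes C :: "'a set" and nx :: "'a \<Rightarrow> 'a"
  assumes C_V: "C \<subseteq> V"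
    and nx_C: "\<And>p. p \<in> C \<Longrightarrow> nx p \<in> C"
    and nx_inj: "\<And>p q. p \<in> C \<Longrightarrow> q \<in> C \<Longrightarrow> nx p = nx q \<longleftrightarrow> p = q"
    and nx_surj: "\<And>p. p \<in> C \<Longrightarrow> \<exists>q\<in>C. nx q = p"
    and adj_C: "\<And>p q. p \<in> C \<Longrightarrow> q \<in> C \<Longrightarrow> p \<sim> q \<longleftrightarrow> q = nx p \<or> p = nx q"
    and nx_ne: "\<And>p. p \<in> C \<Longrightarrow> nx p \<noteq> p" "\<And>p. p \<in> C \<Longrightarrow> nx (nx p) \<noteq> p"
      "\<And>p. p \<in> C \<Longrightarrow> nx (nx (nx p)) \<noteq> p" "\<And>p. p \<in> C \<Longrightarrow> nx (nx (nx (nx p))) \<noteq> p"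
    and nx_closed: "\<And>U. U \<subseteq> C \<Longrightarrow> U \<noteq> {} \<Longrightarrow> (\<And>p. p \<in> U \<Longrightarrow> nx p \<in> U) \<Longrightarrow> U = C"
    and no_hub: "\<And>u w. u \<in> V \<Longrightarrow> w \<in> V \<Longrightarrow> u \<sim> w \<Longrightarrow> (\<And>p. p \<in> C \<Longrightarrow> \<not> w \<sim> p) \<Longrightarrow>
      \<exists>p\<in>C. \<not> u \<sim> p"
begin

lemmas nx_ne' = nx_ne[THEN not_sym]

definition far :: "'a \<Rightarrow> bool" where
  "far w \<longleftrightarrow> w \<in> V \<and> (\<forall>p\<in>C. \<not> w \<sim> p)"

text \<open>
  The edge of \<open>C\<close> to which \<open>u\<close> is attached is named by its first vertex \<open>p\<close>.
\<close>

definition attached :: "'a \<Rightarrow> 'a \<Rightarrow> bool" where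
  "attached u p \<longleftrightarrow> u \<in> V \<and> p \<in> C \<and> (\<forall>q\<in>C. u \<sim> q \<longleftrightarrow> q = p \<or> q = nx p)"

lemma farD: "far w \<Longrightarrow> w \<in> V" "far w \<Longrightarrow> p \<in> C \<Longrightarrow> \<not> w \<sim> p"
  "far w \<Longrightarrow> p \<in> C \<Longrightarrow> \<not> p \<sim> w" "far w \<Longrightarrow> w \<notin> C"
  using adj_commute adj_C nx_C unfolding far_def by blast+

lemma attachedD: "attached u p \<Longrightarrow> u \<in> V" "attached u p \<Longrightarrow> p \<in> C"
  "attached u p \<Longrightarrow> q \<in> C \<Longrightarrow> u \<sim> q \<longleftrightarrow> q = p \<or> q = nx p"
  "attached u p \<Longrightarrow> q \<in> C \<Longrightarrow> q \<sim> u \<longleftrightarrow> q = p \<or> q = nx p"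
  unfolding attached_def using adj_commute by blast+

lemma attached_not_far: "attached u p \<Longrightarrow> \<not> far u"
  using attachedD farD by blast

lemma attached_unique: "attached u p \<Longrightarrow> attached u q \<Longrightarrow> p = q"
  using attachedD nx_ne(2) nx_C by metis

text \<open>Since \<open>u\<close> misses part of \<open>C\<close>, it has a neighbour
  \<open>x\<close> on \<open>C\<close> whose successor is a non-neighbour. Forks using the edge from
  \<open>u\<close> to \<open>w\<close> then force the predecessor of \<open>x\<close> and exclude
  all other neighbours.\<close>

lemma far_nbr_cases:
  assumes w: "far w" and u: "u \<in> V" "u \<sim> w"
  shows "far u \<or> (\<exists>p. attached u p)"
proof (rule ccontr)
  assume neg: "\<not> ?thesis"
  let ?X = "{q \<in> C. u \<sim> q}"
  have "?X \<noteq> {}" using neg u(1) unfolding far_def by blast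
  moreover have "?X \<noteq> C" using no_hub[OF u(1) _ u(2)] w unfolding far_def by blast
  ultimately obtain x where x: "x \<in> C" "u \<sim> x" "\<not> u \<sim> nx x"
    using nx_closed[of ?X] nx_C by blast
  obtain x2 where x2: "x2 \<in> C" "nx x2 = x" using nx_surj[OF x(1)] by blast
  let ?y = "nx x"
  have V: "{u, w, x, ?y, x2} \<subseteq> V" using x x2 u w C_V nx_C farD(1) by blast
  have y: "?y \<in> C" using x nx_C by blast
  have "x2 \<noteq> ?y" "\<not> x2 \<sim> ?y" "x \<sim> ?y" "x \<sim> x2"
    using x x2 y adj_C nx_ne by metis+
  \<comment> \<open>The fork would have centre \<open>x\<close>, leaves \<open>?y\<close>,
    \<open>x2\<close> and long branch \<open>u\<close>, \<open>w\<close>.\<close>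
  then have x2u: "u \<sim> x2"
    using no_fork[of x ?y x2 u w] V x x2 y u w farD adj_sym by (smt (verit) insert_subset)
  \<comment> \<open>The leaves \<open>w\<close>, \<open>q\<close> and the branch \<open>x\<close>,
    \<open>?y\<close> at \<open>u\<close> force an edge from \<open>q\<close> to \<open>?y\<close>.
    Then the leaves \<open>w\<close>, \<open>x2\<close> and the branch \<open>q\<close>,
    \<open>?y\<close> give a fork, where \<open>x2\<close> and \<open>q\<close> are nonadjacent
    because \<open>C\<close> has more than four vertices.\<close>
  have "q = x2 \<or> q = x" if q: "q \<in> C" "u \<sim> q" for q
  proof (rule ccontr)
    assume ne: "\<not> ?thesis"
    have qx: "\<not> q \<sim> x" using ne q x x2 adj_C nx_inj by metis
    have qV: "q \<in> V" using q C_V by blast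
    have "w \<noteq> q" using q farD(4)[OF w] by blast
    then have "q \<sim> ?y"
      using no_fork[of u w q x ?y] V qV u(2) q(2) x \<open>x \<sim> ?y\<close> farD(2)[OF w] q(1) y qx by auto
    then have qy: "q = nx ?y" using adj_C[OF q(1) y] ne q(1) x(1) nx_inj by blast
    have "\<not> x2 \<sim> q" "\<not> x2 \<sim> ?y"
      using qy x2 q(1) adj_C nx_ne nx_inj nx_C by metis+
    moreover have "w \<noteq> x2" using x2 farD(4)[OF w] by blast
    ultimately show False
      using no_fork[of u w x2 q ?y] V qV u(2) q(2) x x2 x2u \<open>q \<sim> ?y\<close> farD(2)[OF w] q(1) y by auto
  qed
  then have "attached u x2"
    unfolding attached_def using u(1) x2 x x2u by blast
  then show False using neg by blast
qed

text \<open>Otherwise \<open>u\<close>, \<open>u'\<close> are the leaves of a fork centred at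
  \<open>p\<close> whose long branch runs backwards along \<open>C\<close>.\<close>

lemma attached_same:
  assumes u: "attached u p" and u': "attached u' p" and ne: "u \<noteq> u'"
  shows "u \<sim> u'"
proof -
  have p: "p \<in> C" using attachedD(2)[OF u] .
  obtain r where r: "r \<in> C" "nx r = p" using nx_surj[OF p] by blast
  obtain s where s: "s \<in> C" "nx s = r" using nx_surj[OF r(1)] by blast
  have "r \<noteq> p" "r \<noteq> nx p" "s \<noteq> p" "s \<noteq> nx p" using r s nx_ne by metis+
  moreover have "p \<sim> r" "r \<sim> s" "\<not> p \<sim> s" using r s p adj_C nx_ne by metis+
  moreover have "{p, u, u', r, s} \<subseteq> V" using p r s C_V attachedD(1)[OF u] attachedD(1)[OF u'] by blast
  ultimately show ?thesis
    using no_fork[of p u u' r s] ne attachedD(3,4)[OF u] attachedD(3,4)[OF u'] p r(1) s(1) by auto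
qed

text \<open>If the two edges share a vertex, their outer ends are taken. The nonadjacency of
  \<open>c\<close> and \<open>c'\<close> allows both to occur in one fork.\<close>

lemma attached_private:
  assumes u: "attached u p" and u': "attached u' p'" and ne: "p \<noteq> p'"
  obtains c c' where "c \<in> C" "c' \<in> C" "u \<sim> c" "\<not> u' \<sim> c" "u' \<sim> c'" "\<not> u \<sim> c'" "\<not> c \<sim> c'"
proof -
  have p: "p \<in> C" "p' \<in> C" using attachedD(2) u u' by blast+
  note at = attachedD(3)[OF u] attachedD(3)[OF u']
  consider "p' = nx p" | "p = nx p'" | "p' \<noteq> nx p" "p \<noteq> nx p'" by blast
  then show ?thesis
  proof cases
    case 1
    then show ?thesis
      using that[of p "nx p'"] p at adj_C[of p "nx p'"] nx_C nx_ne nx_ne' nx_inj by auto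
  next
    case 2
    then show ?thesis
      using that[of "nx p" p'] p at adj_C[of "nx p" p'] nx_C nx_ne nx_ne' nx_inj by auto
  next
    case 3
    then show ?thesis using that[of p p'] p at adj_C[of p p'] ne by auto
  qed
qed

text \<open>Otherwise \<open>u\<close> is the centre of a fork with leaves \<open>x\<close>,
  \<open>c\<close> and long branch \<open>u'\<close>, \<open>c'\<close>, for private neighbours
  \<open>c\<close>, \<open>c'\<close>.\<close>

lemma attached_same_far_nbrs:
  assumes u: "attached u p" and u': "attached u' p'" and ne: "p \<noteq> p'" and "u \<sim> u'"
    and x: "far x" "u \<sim> x"
  shows "u' \<sim> x"
proof -
  obtain c c' where c: "c \<in> C" "c' \<in> C" "u \<sim> c" "\<not> u' \<sim> c" "u' \<sim> c'" "\<not> u \<sim> c'" "\<not> c \<sim> c'"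
    using attached_private[OF u u' ne] by blast
  have "{u, x, c, u', c'} \<subseteq> V" using c C_V attachedD(1) u u' farD(1)[OF x(1)] by blast
  then show ?thesis
    using no_fork[of u x c u' c'] c x \<open>u \<sim> u'\<close> farD[OF x(1)] adj_commute[of u' c] adj_commute[of x u']
    by auto
qed

text \<open>Otherwise \<open>x\<close>, \<open>y\<close> are the leaves of a fork at
  \<open>u\<close> whose long branch is \<open>p\<close> and its predecessor on
  \<open>C\<close>.\<close>

lemma attached_far_nbrs_cliq:
  assumes u: "attached u p" and x: "far x" "u \<sim> x" and y: "far y" "u \<sim> y" and ne: "x \<noteq> y"
  shows "x \<sim> y"
proof -
  have p: "p \<in> C" using attachedD(2)[OF u] .
  obtain r where r: "r \<in> C" "nx r = p" using nx_surj[OF p] by blast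
  have "r \<noteq> p" "r \<noteq> nx p" "p \<sim> r" using r p adj_C nx_ne by metis+
  moreover have "{u, x, y, p, r} \<subseteq> V" using p r C_V attachedD(1)[OF u] farD(1) x y by blast
  ultimately show ?thesis
    using no_fork[of u x y p r] ne attachedD(3)[OF u] x y farD(2) p r(1) by auto
qed

section \<open>The neighbourhood of a far vertex\<close>

context
  fixes v :: 'a and N :: "'a set"
  assumes far_v: "far v" and N_def: "N = {u \<in> V. u \<sim> v}"
    and ex_attached: "\<exists>u\<in>N. \<exists>p. attached u p"
begin

lemma N_D: "y \<in> N \<Longrightarrow> y \<in> V" "y \<in> N \<Longrightarrow> v \<sim> y"
  using N_def adj_sym by auto

lemma N_cases:
  assumes "y \<in> N"
  obtains "far y" | p where "attached y p"
  using far_nbr_cases[OF far_v] assms N_def by blast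

text \<open>Here and in \<open>no_triad_attached1\<close> the fork has centre \<open>v\<close>, and
  its long branch goes through an attached vertex to \<open>C\<close>.\<close>

lemma no_triad_attached2:
  assumes N: "u1 \<in> N" "u2 \<in> N" "x \<in> N" and at: "attached u1 p1" "attached u2 p2" and "far x"
    and stable: "u1 \<noteq> u2" "\<not> u1 \<sim> u2" "\<not> u1 \<sim> x" "\<not> u2 \<sim> x"
  shows False
proof -
  have ne: "p1 \<noteq> p2" using attached_same at stable by blast
  obtain c where c: "c \<in> C" "u1 \<sim> c" "\<not> u2 \<sim> c"
    using attached_private[OF at ne] by blast
  have "{v, u2, x, u1, c} \<subseteq> V" using c C_V N N_D(1) farD(1)[OF far_v] by blast
  moreover have "u2 \<noteq> x" using attached_not_far at \<open>far x\<close> by blast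
  ultimately show False
    using no_fork[of v u2 x u1 c] c N N_D(2) stable farD[OF far_v] farD[OF \<open>far x\<close>]
      adj_commute[of u2 u1] adj_commute[of x u1] by auto
qed

lemma no_triad_attached1:
  assumes N: "u \<in> N" "x \<in> N" "y \<in> N" and at: "attached u p" and far: "far x" "far y"
    and stable: "x \<noteq> y" "\<not> x \<sim> y" "\<not> u \<sim> x" "\<not> u \<sim> y"
  shows False
proof -
  have p: "p \<in> C" "u \<sim> p" using attachedD(2,3)[OF at] by blast+
  have "{v, x, y, u, p} \<subseteq> V" using p C_V N N_D(1) farD(1)[OF far_v] by blast
  then show False
    using no_fork[of v x y u p] p N N_D(2) stable farD[OF far_v] farD[OF far(1)] farD[OF far(2)]
      adj_commute[of u x] adj_commute[of u y] by auto
qed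

text \<open>By forks centred at \<open>v\<close>, both ends of each attaching edge lie on the other
  two edges. Three distinct edges of a cycle do so only in a triangle.\<close>

lemma no_triad_attached3:
  assumes N: "u1 \<in> N" "u2 \<in> N" "u3 \<in> N"
    and at: "attached u1 p1" "attached u2 p2" "attached u3 p3"
    and ne: "u1 \<noteq> u2" "u1 \<noteq> u3" "u2 \<noteq> u3"
    and stable: "\<not> u1 \<sim> u2" "\<not> u1 \<sim> u3" "\<not> u2 \<sim> u3"
  shows False
proof -
  have p: "p1 \<in> C" "p2 \<in> C" "p3 \<in> C" using attachedD(2) at by blast+
  have pne: "p1 \<noteq> p2" "p1 \<noteq> p3" "p2 \<noteq> p3" using attached_same at ne stable by blast+
  have covered: "y1 \<sim> c \<or> y2 \<sim> c"
    if y: "y1 \<in> N" "y2 \<in> N" "y3 \<in> N" "y1 \<noteq> y2" "\<not> y1 \<sim> y2" "\<not> y1 \<sim> y3" "\<not> y2 \<sim> y3"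
      and c: "c \<in> C" "y3 \<sim> c" for y1 y2 y3 c
  proof -
    have "{v, y1, y2, y3, c} \<subseteq> V" using c C_V y N_D(1) farD(1)[OF far_v] by blast
    then show ?thesis
      using no_fork[of v y1 y2 y3 c] y N_D(2) c farD(2)[OF far_v] by blast
  qed
  have st': "\<not> u2 \<sim> u1" "\<not> u3 \<sim> u1" "\<not> u3 \<sim> u2" using stable adj_sym by blast+
  have 3: "p3 = nx p1 \<or> p3 = nx p2" "nx p3 = p1 \<or> nx p3 = p2"
    using covered[of u1 u2 u3 p3] covered[of u1 u2 u3 "nx p3"] N ne stable p pne nx_C nx_inj
      attachedD(3)[OF at(1)] attachedD(3)[OF at(2)] attachedD(3)[OF at(3)] by metis+
  have 1: "p1 = nx p2 \<or> p1 = nx p3" "nx p1 = p2 \<or> nx p1 = p3"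
    using covered[of u2 u3 u1 p1] covered[of u2 u3 u1 "nx p1"] N ne stable st' p pne nx_C nx_inj
      attachedD(3)[OF at(1)] attachedD(3)[OF at(2)] attachedD(3)[OF at(3)] by metis+
  show False using 1 3 p pne nx_ne nx_inj by metis
qed

lemma no_triad:
  assumes N: "x \<in> N" "y \<in> N" "z \<in> N" and ne: "x \<noteq> y" "x \<noteq> z" "y \<noteq> z"
    and stable: "\<not> x \<sim> y" "\<not> x \<sim> z" "\<not> y \<sim> z"
  shows False
proof -
  have st': "\<not> y \<sim> x" "\<not> z \<sim> x" "\<not> z \<sim> y" using stable adj_sym by blast+
  show False
  proof (cases "far x \<and> far y \<and> far z")
    case True
    obtain u p where u: "u \<in> N" "attached u p" using ex_attached by blast
    \<comment> \<open>The far neighbours of \<open>u\<close> form a clique, so \<open>u\<close> sees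
      at most one vertex of the triad.\<close>
    have "\<not> u \<sim> x \<and> \<not> u \<sim> y \<or> \<not> u \<sim> x \<and> \<not> u \<sim> z \<or> \<not> u \<sim> y \<and> \<not> u \<sim> z"
      using attached_far_nbrs_cliq[OF u(2)] True ne stable by blast
    then show False using no_triad_attached1[OF u(1) _ _ u(2)] N ne True stable by blast
  next
    case False
    have "far w \<or> (\<exists>p. attached w p)" if "w \<in> N" for w using N_cases[OF that] by blast
    then have "far x \<or> (\<exists>p. attached x p)" "far y \<or> (\<exists>p. attached y p)" "far z \<or> (\<exists>p. attached z p)"
      using N by blast+
    then consider
        (a1) p q r where "attached x p" "attached y q" "attached z r"
      | (b1) p q where "attached x p" "attached y q" "far z"
      | (b2) p q where "attached x p" "far y" "attached z q"
      | (b3) p q where "far x" "attached y p" "attached z q"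
      | (c1) p where "attached x p" "far y" "far z"
      | (c2) p where "far x" "attached y p" "far z"
      | (c3) p where "far x" "far y" "attached z p"
      using False by blast
    then show False
    proof cases
      case a1
      then show False using no_triad_attached3[OF N a1 ne stable] by blast
    next
      case b1
      then show False using no_triad_attached2[of x y z] N ne stable st' by blast
    next
      case b2
      then show False using no_triad_attached2[of x z y] N ne stable st' by blast
    next
      case b3
      then show False using no_triad_attached2[of y z x] N ne stable st' by blast
    next
      case c1
      then show False using no_triad_attached1[of x y z] N ne stable st' by blast
    next
      case c2
      then show False using no_triad_attached1[of y x z] N ne stable st' by blast
    next
      case c3
      then show False using no_triad_attached1[of z x y] N ne stable st' by blast
    qed
  qed
qed

lemma fork_at_attached:
  assumes N: "u \<in> N" "u' \<in> N" "u'' \<in> N" and nbr: "u \<sim> u'" "u \<sim> u''" "\<not> u' \<sim> u''"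
    and c: "c \<in> C" "u \<sim> c" "\<not> u' \<sim> c" "\<not> u'' \<sim> c"
    and c': "c' \<in> C" "u' \<sim> c'" "\<not> u \<sim> c'" "\<not> u'' \<sim> c'" and cc': "\<not> c \<sim> c'"
  shows False
proof -
  have "{u, u'', c, u', c'} \<subseteq> V" using c c' C_V N N_D(1) by blast
  moreover have "u'' \<noteq> c" using c(1) N N_D(2) farD(2)[OF far_v] by blast
  ultimately show False
    using no_fork[of u u'' c u' c'] nbr c c' cc' adj_sym by blast
qed

text \<open>If the edges of \<open>u\<close> and \<open>u''\<close> were disjoint, there would be a
  fork at \<open>u\<close>. Its long branch goes through \<open>u'\<close> (fact \<open>F\<close>)
  or \<open>u''\<close> (fact \<open>G\<close>), depending on how the three edges overlap.\<close>

lemma attached_nonadjacent_aux: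
  assumes N: "u \<in> N" "u' \<in> N" "u'' \<in> N"
    and at: "attached u p" "attached u' p'" "attached u'' p''" and ne: "p' \<noteq> p" "p'' \<noteq> p"
    and nbr: "u \<sim> u'" "u \<sim> u''" "u' \<noteq> u''" "\<not> u' \<sim> u''"
  shows "p'' = nx p \<or> p = nx p''"
proof (rule ccontr)
  assume neg: "\<not> ?thesis"
  have p: "p \<in> C" "p' \<in> C" "p'' \<in> C" using attachedD(2) at by blast+
  have ne': "p' \<noteq> p''" using attached_same at nbr by blast
  note A = attachedD(3)[OF at(1)] attachedD(3)[OF at(2)] attachedD(3)[OF at(3)]
  have nbr': "\<not> u'' \<sim> u'" using nbr adj_sym by blast
  note F = fork_at_attached[OF N nbr(1,2,4)] and G = fork_at_attached[OF N(1,3,2) nbr(2,1) nbr']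
  note S = nx_C nx_ne nx_ne' nx_inj
  consider "p' = nx p" "p'' = nx (nx p)" | "p' = nx p" "p'' \<noteq> nx (nx p)"
    | "p = nx p'" "p' = nx p''" | "p = nx p'" "p' \<noteq> nx p''"
    | "p' \<noteq> nx p" "p \<noteq> nx p'" "p' \<noteq> nx p''" | "p' \<noteq> nx p" "p \<noteq> nx p'" "p' = nx p''"
    by blast
  then show False
  proof cases
    case 1
    then show False using G[of p "nx p''"] p A adj_C[of p "nx p''"] neg ne ne' by (auto simp: S)
  next
    case 2
    then show False using F[of p "nx p'"] p A adj_C[of p "nx p'"] neg ne ne' by (auto simp: S)
  next
    case 3
    then show False using G[of "nx p" p''] p A adj_C[of "nx p" p''] neg ne ne' by (auto simp: S)
  next
    case 4
    then show False using F[of "nx p" p'] p A adj_C[of "nx p" p'] neg ne ne' by (auto simp: S)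
  next
    case 5
    then show False using F[of p p'] p A adj_C[of p p'] neg ne ne' by (auto simp: S)
  next
    case 6
    then show False
      using F[of "nx p" "nx p'"] p A adj_C[of "nx p" "nx p'"] neg ne ne' by (auto simp: S)
  qed
qed

text \<open>Both edges are next to that of \<open>u\<close>, and they differ because vertices at one
  edge are adjacent; so there is one on each side.\<close>

lemma attached_nonadjacent:
  assumes N: "u \<in> N" "u' \<in> N" "u'' \<in> N"
    and at: "attached u p" "attached u' p'" "attached u'' p''" and ne: "p' \<noteq> p" "p'' \<noteq> p"
    and nbr: "u \<sim> u'" "u \<sim> u''" "u' \<noteq> u''" "\<not> u' \<sim> u''"
  shows "p' = nx p \<and> p = nx p'' \<or> p'' = nx p \<and> p = nx p'"
proof -
  have "p'' = nx p \<or> p = nx p''"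
    using attached_nonadjacent_aux[OF N at ne nbr] .
  moreover have "p' = nx p \<or> p = nx p'"
    using attached_nonadjacent_aux[OF N(1,3,2) at(1,3,2) ne(2,1) nbr(2,1) nbr(3)[symmetric]]
      nbr(4) adj_sym by blast
  moreover have "p' \<noteq> p''" using attached_same at nbr by blast
  ultimately show ?thesis using nx_inj attachedD(2) at by blast
qed

text \<open>
  Only the middle vertices fail to give the three cliques of \<open>three_cliqs_of_not_middle\<close>.
\<close>

definition middle :: "'a \<Rightarrow> 'a \<Rightarrow> 'a \<Rightarrow> bool" where
  "middle u' u u'' \<longleftrightarrow> u \<in> N \<and> u' \<in> N \<and> u'' \<in> N \<and> u \<sim> u' \<and> u \<sim> u'' \<and> \<not> u' \<sim> u'' \<and>
    (\<exists>p. attached u' p \<and> attached u (nx p) \<and> attached u'' (nx (nx p)))"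

text \<open>\<open>?K1\<close> is a clique by \<open>no_triad\<close>, and \<open>?K2\<close>, which
  contains \<open>u\<close>, by \<open>attached_same\<close>. In \<open>?K3\<close> a nonadjacent
  pair would have to be attached on the two sides of the edge of \<open>u\<close>.\<close>

lemma three_cliqs_of_not_middle:
  assumes u: "u \<in> N" "attached u p" and nm: "\<nexists>u' u''. middle u' u u''"
  shows "\<exists>K1 K2 K3. cliq K1 \<and> cliq K2 \<and> cliq K3 \<and> N = K1 \<union> K2 \<union> K3"
proof -
  let ?K1 = "{y \<in> N. y \<noteq> u \<and> \<not> u \<sim> y}"
  let ?K2 = "{y \<in> N. attached y p}"
  let ?K3 = "{y \<in> N. u \<sim> y \<and> \<not> attached y p}"
  have "cliq ?K1"
    unfolding cliq_def using no_triad[of u] u by blast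
  moreover have "cliq ?K2"
    unfolding cliq_def using attached_same by blast
  moreover have "x \<sim> y" if xy: "x \<in> ?K3" "y \<in> ?K3" "x \<noteq> y" for x y
  proof -
    have "x \<in> N" "y \<in> N" "u \<sim> x" "u \<sim> y" using xy by blast+
    have far_att: "b \<sim> a" if "far a" "attached b q" "a \<in> ?K3" "b \<in> ?K3" for a b q
      using attached_same_far_nbrs[OF u(2) that(2) _ _ that(1)] that u by blast
    show ?thesis
    proof (rule N_cases[OF \<open>x \<in> N\<close>])
      assume fx: "far x"
      show ?thesis
      proof (rule N_cases[OF \<open>y \<in> N\<close>])
        assume "far y"
        then show ?thesis using attached_far_nbrs_cliq[OF u(2) fx] xy by blast
      next
        fix q assume "attached y q"
        then show ?thesis using far_att[OF fx] xy adj_sym by blast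
      qed
    next
      fix q assume x: "attached x q"
      show ?thesis
      proof (rule N_cases[OF \<open>y \<in> N\<close>])
        assume "far y"
        then show ?thesis using far_att[OF _ x] xy by blast
      next
        fix r assume y: "attached y r"
        show ?thesis
        proof (rule ccontr)
          assume nadj: "\<not> x \<sim> y"
          have "q \<noteq> p" "r \<noteq> p" using x y xy by blast+
          then have "q = nx p \<and> p = nx r \<or> r = nx p \<and> p = nx q"
            using attached_nonadjacent[OF u(1) \<open>x \<in> N\<close> \<open>y \<in> N\<close> u(2) x y] xy nadj by blast
          then have "middle y u x \<or> middle x u y"
            using u x y xy nadj adj_sym unfolding middle_def by blast
          then show False using nm by blast
        qed
      qed
    qed
  qed
  then have "cliq ?K3" unfolding cliq_def by blast
  moreover have "N = ?K1 \<union> ?K2 \<union> ?K3" using u by blast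
  ultimately show ?thesis by blast
qed

section \<open>The exceptional cycle of length five\<close>

definition pentagon :: "'a \<Rightarrow> 'a \<Rightarrow> 'a \<Rightarrow> 'a \<Rightarrow> 'a \<Rightarrow> 'a \<Rightarrow> bool" where
  "pentagon p u0 u1 u2 u3 u4 \<longleftrightarrow> p \<in> C \<and> nx (nx (nx (nx (nx p)))) = p \<and>
    u0 \<in> N \<and> u1 \<in> N \<and> u2 \<in> N \<and> u3 \<in> N \<and> u4 \<in> N \<and>
    attached u0 p \<and> attached u1 (nx p) \<and> attached u2 (nx (nx p)) \<and>
    attached u3 (nx (nx (nx p))) \<and> attached u4 (nx (nx (nx (nx p)))) \<and>
    u0 \<sim> u1 \<and> u1 \<sim> u2 \<and> u2 \<sim> u3 \<and> u3 \<sim> u4 \<and> u4 \<sim> u0 \<and>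
    \<not> u0 \<sim> u2 \<and> \<not> u1 \<sim> u3 \<and> \<not> u2 \<sim> u4 \<and> \<not> u3 \<sim> u0 \<and> \<not> u4 \<sim> u1"

lemma pentagon_rotate: "pentagon p u0 u1 u2 u3 u4 \<Longrightarrow> pentagon (nx p) u1 u2 u3 u4 u0"
  unfolding pentagon_def using nx_C by simp

text \<open>The ends of a middle triple are middle vertices too, which extends the triple to
  \<open>u3\<close> and \<open>u4\<close>. Both miss \<open>u1\<close>, so they are adjacent, and
  this edge is what bounds the length of \<open>C\<close>.\<close>

lemma ex_pentagon:
  assumes all: "\<And>u p. u \<in> N \<Longrightarrow> attached u p \<Longrightarrow> \<exists>u' u''. middle u' u u''"
  shows "\<exists>p u0 u1 u2 u3 u4. pentagon p u0 u1 u2 u3 u4"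
proof -
  \<comment> \<open>Adjacency of \<open>w\<close> to both ends is excluded since \<open>C\<close>
    has more than four vertices, adjacency to neither gives a triad, and adjacency to
    \<open>u\<close> would force adjacency to both ends.\<close>
  have not_middle: "\<not> w \<sim> u \<and> (w \<sim> u' \<longleftrightarrow> \<not> w \<sim> u'')"
    if m: "u \<in> N" "u' \<in> N" "u'' \<in> N" "u \<sim> u'" "u \<sim> u''" "\<not> u' \<sim> u''"
      "attached u' p" "attached u (nx p)" "attached u'' (nx (nx p))"
      and w: "w \<in> N" "attached w q" "q \<noteq> p" "q \<noteq> nx p" "q \<noteq> nx (nx p)" for u' u u'' w p q
  proof -
    have C: "p \<in> C" "nx p \<in> C" "nx (nx p) \<in> C" "q \<in> C" using m w attachedD(2) by blast+
    have ne: "u' \<noteq> u''" "w \<noteq> u'" "w \<noteq> u" "w \<noteq> u''" using attached_unique m w nx_ne(2) C by metis+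
    have both: "\<not> (w \<sim> u' \<and> w \<sim> u'')"
    proof
      assume "w \<sim> u' \<and> w \<sim> u''"
      then have "p = nx q \<and> q = nx (nx (nx p)) \<or> nx (nx p) = nx q \<and> q = nx p"
        using attached_nonadjacent[OF w(1) m(2,3) w(2) m(7,9)] w(3,5) m(6) ne by metis
      then show False using w C nx_ne by metis
    qed
    have "w \<sim> u' \<and> w \<sim> u''" if wu: "w \<sim> u"
    proof (intro conjI; rule ccontr)
      assume "\<not> w \<sim> u'"
      then have "q = nx (nx p) \<and> nx p = nx p \<or> p = nx (nx p) \<and> nx p = nx q"
        using attached_nonadjacent[OF m(1) w(1) m(2) m(8) w(2) m(7) w(4)] nx_ne(1) C ne m(4)
          adj_sym wu by metis
      then show False using w nx_inj C by metis
    next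
      assume "\<not> w \<sim> u''"
      then have "q = nx (nx p) \<and> nx p = nx (nx (nx p)) \<or> nx (nx p) = nx (nx p) \<and> nx p = nx q"
        using attached_nonadjacent[OF m(1) w(1) m(3) m(8) w(2) m(9) w(4)] nx_ne(1) C ne m(5)
          adj_sym wu by metis
      then show False using w nx_inj C by metis
    qed
    then have wu: "\<not> w \<sim> u" using both by blast
    have "w \<sim> u' \<or> w \<sim> u''" using no_triad[of w u' u''] w m ne by blast
    then show ?thesis using both wu by blast
  qed
  obtain u1 q where "u1 \<in> N" "attached u1 q" using ex_attached by blast
  then obtain u0 u2 where m1: "middle u0 u1 u2" using all by blast
  then obtain p where m: "u1 \<in> N" "u0 \<in> N" "u2 \<in> N" "u1 \<sim> u0" "u1 \<sim> u2" "\<not> u0 \<sim> u2"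
    "attached u0 p" "attached u1 (nx p)" "attached u2 (nx (nx p))"
    unfolding middle_def by blast
  let ?p2 = "nx (nx p)" and ?p3 = "nx (nx (nx p))"
  have C: "p \<in> C" "nx p \<in> C" "?p2 \<in> C" "?p3 \<in> C" "nx ?p3 \<in> C" using m(7) attachedD(2) nx_C by blast+
  obtain t u3 where "middle t u2 u3" using all m by blast
  then obtain r where r: "u3 \<in> N" "u2 \<sim> u3" "attached u2 (nx r)" "attached u3 (nx (nx r))"
    unfolding middle_def by blast
  have u3: "attached u3 ?p3" using r attached_unique[OF m(9) r(3)] by simp
  obtain t' u4 where "middle u4 u0 t'" using all m by blast
  then obtain s where s: "u4 \<in> N" "u0 \<sim> u4" "attached u0 (nx s)" "attached u4 s"
    unfolding middle_def by blast
  have sp: "nx s = p" using attached_unique[OF m(7) s(3)] by simp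
  have sC: "s \<in> C" using attachedD(2) s by blast
  have "?p3 \<noteq> p" "?p3 \<noteq> nx p" "?p3 \<noteq> ?p2" using C nx_ne by metis+
  then have 3: "\<not> u3 \<sim> u1" "\<not> u3 \<sim> u0"
    using not_middle[OF m r(1) u3] r(2) adj_sym by blast+
  have "s \<noteq> p" "s \<noteq> nx p" "s \<noteq> ?p2" using sp sC C nx_ne by metis+
  then have 4: "\<not> u4 \<sim> u1" "\<not> u4 \<sim> u2"
    using not_middle[OF m s(1,4)] s(2) adj_sym by blast+
  have ne: "?p3 \<noteq> s" using sp C nx_ne by metis
  have "u3 \<noteq> u4" "u1 \<noteq> u3" "u1 \<noteq> u4" "u2 \<noteq> u4"
    using ne attached_unique u3 s(4) m(8,9) C nx_ne \<open>s \<noteq> nx p\<close> \<open>s \<noteq> ?p2\<close> by metis+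
  then have 34: "u3 \<sim> u4"
    using no_triad[of u1 u3 u4] m(1) r(1) s(1) 3 4 adj_sym by blast
  \<comment> \<open>The edge of \<open>u3\<close> lies between those of its nonadjacent neighbours
    \<open>u2\<close> and \<open>u4\<close>. With \<open>nx s = p\<close> the cycle closes after
    five edges.\<close>
  have "s = nx ?p3 \<and> ?p3 = nx ?p2 \<or> ?p2 = nx ?p3 \<and> ?p3 = nx s"
    using attached_nonadjacent[OF r(1) m(3) s(1) u3 m(9) s(4)] nx_ne ne C \<open>u2 \<noteq> u4\<close> 4(2) 34 r(2)
      adj_sym by metis
  then have "s = nx ?p3" using nx_ne C by metis
  then have "pentagon p u0 u1 u2 u3 u4"
    unfolding pentagon_def using sp C m r s u3 3 4 34 adj_sym by blast
  then show ?thesis by blast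
qed

text \<open>The vertices attached at one edge behave like the pentagon vertex there;
  \<open>pentagon_rotate\<close> carries this to the other edges.\<close>

lemma pentagon_class:
  assumes pent: "pentagon p u0 u1 u2 u3 u4" and z: "z \<in> N" "attached z (nx p)"
  shows "\<not> z \<sim> u3" "\<not> z \<sim> u4" "u0 \<sim> z" "u2 \<sim> z"
proof -
  have P: "p \<in> C" "nx (nx (nx (nx (nx p)))) = p"
    and N: "u0 \<in> N" "u1 \<in> N" "u2 \<in> N" "u3 \<in> N" "u4 \<in> N"
    and at: "attached u0 p" "attached u2 (nx (nx p))" "attached u3 (nx (nx (nx p)))"
      "attached u4 (nx (nx (nx (nx p))))"
    and adj: "u3 \<sim> u4" "\<not> u0 \<sim> u2" "\<not> u2 \<sim> u4" "\<not> u3 \<sim> u0" "\<not> u0 \<sim> u3" "u4 \<sim> u3"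
    using pent adj_sym unfolding pentagon_def by blast+
  have C: "nx p \<in> C" "nx (nx p) \<in> C" "nx (nx (nx p)) \<in> C" "nx (nx (nx (nx p))) \<in> C"
    using P nx_C by blast+
  note S = nx_ne nx_ne' nx_inj P C
  have att_ne: "y \<noteq> w" if "attached y q" "attached w r" "q \<noteq> r" for y w q r
    using that attached_unique by blast
  have zne: "z \<noteq> u0" "z \<noteq> u2" "z \<noteq> u3" "z \<noteq> u4" "u2 \<noteq> u4" "u0 \<noteq> u3" "u0 \<noteq> u2"
    using att_ne[OF z(2) at(1)] att_ne[OF z(2) at(2)] att_ne[OF z(2) at(3)] att_ne[OF z(2) at(4)]
      att_ne[OF at(2,4)] att_ne[OF at(1,3)] att_ne[OF at(1,2)] by (auto simp: S)
  have z02: "z \<sim> u0 \<or> z \<sim> u2" using no_triad[of z u0 u2] z(1) N adj zne by blast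
  show 3: "\<not> z \<sim> u3"
  proof
    assume z3: "z \<sim> u3"
    \<comment> \<open>Otherwise \<open>z\<close> and \<open>u4\<close> are nonadjacent neighbours of
      \<open>u3\<close>, although the edge of \<open>z\<close> is not next to that of
      \<open>u3\<close>.\<close>
    have z4: "z \<sim> u4"
      using attached_nonadjacent[OF N(4) z(1) N(5) at(3) z(2) at(4)] adj_sym[OF z3] adj(1) zne
      by (auto simp: S)
    show False using z02
    proof
      assume "z \<sim> u0"
      then show False
        using attached_nonadjacent[OF z(1) N(1) N(4) z(2) at(1) at(3)] z3 adj zne by (auto simp: S)
    next
      assume "z \<sim> u2"
      then show False
        using attached_nonadjacent[OF z(1) N(3) N(5) z(2) at(2) at(4)] z4 adj zne by (auto simp: S)
    qed
  qed
  show 4: "\<not> z \<sim> u4"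
  proof
    assume z4: "z \<sim> u4"
    show False
      using attached_nonadjacent[OF N(5) z(1) N(4) at(4) z(2) at(3)] adj_sym[OF z4] adj(6) 3 zne
      by (auto simp: S)
  qed
  show "u2 \<sim> z" using no_triad[of z u4 u2] z(1) N adj zne 4 adj_sym by blast
  show "u0 \<sim> z" using no_triad[of z u3 u0] z(1) N adj zne 3 adj_sym by blast
qed

text \<open>Two consecutive classes form a clique because both miss the pentagon vertex opposite to
  them. Two such pairs leave one class over, and the far vertices join the first pair.\<close>

lemma three_cliqs_of_pentagon:
  assumes pent: "pentagon p u0 u1 u2 u3 u4"
  shows "\<exists>K1 K2 K3. cliq K1 \<and> cliq K2 \<and> cliq K3 \<and> N = K1 \<union> K2 \<union> K3"
proof -
  define K where "K q = {y \<in> N. attached y q}" for q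
  let ?p1 = "nx p" and ?p2 = "nx (nx p)" and ?p3 = "nx (nx (nx p))"
    and ?p4 = "nx (nx (nx (nx p)))"
  let ?Q = "{y \<in> N. far y}"
  note pent1 = pentagon_rotate[OF pent]
  note pent2 = pentagon_rotate[OF pent1]
  note pent3 = pentagon_rotate[OF pent2]
  note pent4 = pentagon_rotate[OF pent3]
  have P: "p \<in> C" "nx ?p4 = p" and N: "u0 \<in> N" "u1 \<in> N" "u2 \<in> N" "u3 \<in> N"
    and at: "attached u0 p" "attached u1 ?p1" "attached u2 ?p2" "attached u3 ?p3"
    and adj: "u0 \<sim> u1" "u1 \<sim> u2" "\<not> u0 \<sim> u2"
    using pent unfolding pentagon_def by blast+
  have C: "?p1 \<in> C" "?p2 \<in> C" "?p3 \<in> C" "?p4 \<in> C" using P nx_C by blast+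
  note S = nx_ne nx_ne' nx_inj P C
  have att_ne: "y \<noteq> z" if "attached y q" "attached z r" "q \<noteq> r" for y z q r
    using that attached_unique by blast
  have class0: "\<not> z \<sim> u3" "z \<sim> u1" if "z \<in> K p" for z
    using pentagon_class[OF pent4, of z] that P adj_sym unfolding K_def by auto
  have class1: "\<not> z \<sim> u3" "z \<sim> u0" if "z \<in> K ?p1" for z
    using pentagon_class[OF pent, of z] that adj_sym unfolding K_def by auto
  have class2: "\<not> z \<sim> u0" if "z \<in> K ?p2" for z
    using pentagon_class[OF pent1, of z] that unfolding K_def by auto
  have class3: "\<not> z \<sim> u0" if "z \<in> K ?p3" for z
    using pentagon_class[OF pent2, of z] that unfolding K_def by auto
  have K: "cliq (K q)" for q unfolding cliq_def K_def using attached_same by blast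
  have "y \<sim> z" if "y \<in> K p" "z \<in> K ?p1" for y z
  proof -
    have y: "y \<in> N" "attached y p" and z: "z \<in> N" "attached z ?p1" using that unfolding K_def by blast+
    have "y \<noteq> z" "y \<noteq> u3" "z \<noteq> u3"
      using att_ne[OF y(2) z(2)] att_ne[OF y(2) at(4)] att_ne[OF z(2) at(4)] by (auto simp: S)
    then show ?thesis using no_triad[of y z u3] y z N class0 class1 that by blast
  qed
  then have K01: "cliq (K p \<union> K ?p1)" using cliq_Un[OF K K] by blast
  have "y \<sim> z" if "y \<in> K ?p2" "z \<in> K ?p3" for y z
  proof -
    have y: "y \<in> N" "attached y ?p2" and z: "z \<in> N" "attached z ?p3" using that unfolding K_def by blast+
    have "y \<noteq> z" "y \<noteq> u0" "z \<noteq> u0"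
      using att_ne[OF y(2) z(2)] att_ne[OF y(2) at(1)] att_ne[OF z(2) at(1)] by (auto simp: S)
    then show ?thesis using no_triad[of y z u0] y z N class2 class3 that by blast
  qed
  then have K23: "cliq (K ?p2 \<union> K ?p3)" using cliq_Un[OF K K] by blast
  \<comment> \<open>As there is no triad, \<open>x\<close> sees \<open>u0\<close> or
    \<open>u2\<close>, and adjacency to a far vertex passes along the path \<open>u0\<close>,
    \<open>u1\<close>, \<open>u2\<close>.\<close>
  have xu: "u0 \<sim> x" "u1 \<sim> x" if x: "x \<in> ?Q" for x
  proof -
    have fx: "far x" and xN: "x \<in> N" using x by blast+
    have 10: "u0 \<sim> x" if "u1 \<sim> x"
      using attached_same_far_nbrs[OF at(2,1) _ adj_sym[OF adj(1)] fx that] nx_ne(1)[OF P(1)] by blast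
    have 01: "u1 \<sim> x" if "u0 \<sim> x"
      using attached_same_far_nbrs[OF at(1,2) _ adj(1) fx that] nx_ne'(1)[OF P(1)] by blast
    have 21: "u1 \<sim> x" if "u2 \<sim> x"
      using attached_same_far_nbrs[OF at(3,2) _ adj_sym[OF adj(2)] fx that] nx_ne(1)[OF C(1)] by blast
    have "u0 \<noteq> u2" using att_ne[OF at(1,3)] by (auto simp: S)
    then show "u1 \<sim> x"
      using no_triad_attached2[OF N(1,3) xN at(1,3) fx] adj 01 21 by blast
    then show "u0 \<sim> x" using 10 by blast
  qed
  have "cliq ?Q"
    unfolding cliq_def using attached_far_nbrs_cliq[OF at(1)] xu(1) by blast
  moreover have "y \<sim> x" if "x \<in> ?Q" "y \<in> K p \<union> K ?p1" for x y
  proof (cases "y \<in> K p")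
    case True
    then have "attached y p" unfolding K_def by blast
    then show ?thesis
      using attached_same_far_nbrs[OF at(2), of y p x] class0(2)[OF True] xu(2)[OF that(1)] that(1)
        adj_sym nx_ne(1)[OF P(1)] by blast
  next
    case False
    then have y: "y \<in> K ?p1" using that by blast
    then have "attached y ?p1" unfolding K_def by blast
    then show ?thesis
      using attached_same_far_nbrs[OF at(1), of y ?p1 x] class1(2)[OF y] xu(1)[OF that(1)] that(1)
        adj_sym nx_ne'(1)[OF P(1)] by blast
  qed
  ultimately have "cliq ((K p \<union> K ?p1) \<union> ?Q)" using cliq_Un[OF K01] by blast
  moreover have "N = ((K p \<union> K ?p1) \<union> ?Q) \<union> (K ?p2 \<union> K ?p3) \<union> K ?p4"
  proof -
    have "{p, ?p1, ?p2, ?p3, ?p4} = C"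
      by (rule nx_closed) (use P C in auto)
    then have "y \<in> K p \<union> K ?p1 \<union> K ?p2 \<union> K ?p3 \<union> K ?p4" if "y \<in> N" "attached y q" for y q
      using attachedD(2)[OF that(2)] that unfolding K_def by blast
    then show ?thesis using N_cases unfolding K_def by blast
  qed
  ultimately show ?thesis using K23 K[of ?p4] by blast
qed

lemma far_nbrs_three_cliqs:
  "\<exists>K1 K2 K3. cliq K1 \<and> cliq K2 \<and> cliq K3 \<and> N = K1 \<union> K2 \<union> K3"
proof (cases "\<exists>u\<in>N. \<exists>p. attached u p \<and> (\<nexists>u' u''. middle u' u u'')")
  case True
  then show ?thesis using three_cliqs_of_not_middle by blast
next
  case False
  then have "\<exists>p u0 u1 u2 u3 u4. pentagon p u0 u1 u2 u3 u4" by (intro ex_pentagon) blast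
  then show ?thesis using three_cliqs_of_pentagon by blast
qed

end

end

section \<open>Attachments of minimal imperfect sets\<close>

context fork_free
begin

text \<open>Arithmetic modulo \<open>n\<close> is confined to this place; the arguments about
  \<open>C\<close> see only the successor map.\<close>

lemma hole_fork_free_cycle:
  assumes n: "5 \<le> n" and h: "hole n h" "h ` {..<n} \<subseteq> V"
    and no_hub: "\<And>u w. u \<in> V \<Longrightarrow> w \<in> V \<Longrightarrow> u \<sim> w \<Longrightarrow> (\<And>i. i < n \<Longrightarrow> \<not> w \<sim> h i) \<Longrightarrow>
      \<exists>i<n. \<not> u \<sim> h i"
  shows "\<exists>nx. fork_free_cycle adj V (h ` {..<n}) nx"
proof -
  let ?C = "h ` {..<n}"
  define nx where "nx p = h (Suc (the_inv_into {..<n} h p) mod n)" for p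
  have inj: "inj_on h {..<n}" using h unfolding hole_def by blast
  have h_eq: "h i = h j \<longleftrightarrow> i = j" if "i < n" "j < n" for i j
    using inj_on_eq_iff[OF inj] that by blast
  have nx_h: "nx (h (i mod n)) = h (Suc i mod n)" for i
    using the_inv_into_f_f[OF inj, of "i mod n"] n by (simp add: nx_def mod_Suc_eq)
  \<comment> \<open>The redundant \<open>mod n\<close> lets \<open>nx_h\<close> be applied
    repeatedly.\<close>
  have C: "\<exists>i<n. p = h (i mod n)" if "p \<in> ?C" for p
    using that by auto
  have shift: "h ((i + k) mod n) \<noteq> h (i mod n)" if "0 < k" "k < n" "i < n" for i k
  proof -
    have "(i + k) mod n \<noteq> i mod n"
      using that by (cases "i + k < n") (auto simp: mod_if)
    then show ?thesis using h_eq n by simp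
  qed
  have "fork_free_cycle adj V ?C nx"
  proof (intro fork_free_cycle.intro fork_free_cycle_axioms.intro)
    show "fork_free adj V" by (rule fork_free_axioms)
    show "?C \<subseteq> V" by (rule h(2))
    show nx_C: "nx p \<in> ?C" if "p \<in> ?C" for p
      using n unfolding nx_def by simp
    show "nx p = nx q \<longleftrightarrow> p = q" if pq: "p \<in> ?C" "q \<in> ?C" for p q
    proof -
      obtain i j where ij: "i < n" "p = h (i mod n)" "j < n" "q = h (j mod n)" using C[OF pq(1)] C[OF pq(2)] by blast
      then have "nx p = nx q \<longleftrightarrow> Suc i mod n = Suc j mod n"
        using nx_h[of i] nx_h[of j] h_eq[of "Suc i mod n" "Suc j mod n"] n by simp
      also have "\<dots> \<longleftrightarrow> i = j" using ij by (auto simp: mod_Suc)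
      finally show ?thesis using ij h_eq by simp
    qed
    show "\<exists>q\<in>?C. nx q = p" if p: "p \<in> ?C" for p
    proof -
      obtain i where i: "i < n" "p = h (i mod n)" using C[OF p] by blast
      have "nx (h ((i + (n - 1)) mod n)) = h (Suc (i + (n - 1)) mod n)" by (rule nx_h)
      also have "Suc (i + (n - 1)) = i + n" using n by simp
      finally have "nx (h ((i + (n - 1)) mod n)) = p" using i by simp
      then show ?thesis using n by auto
    qed
    show "p \<sim> q \<longleftrightarrow> q = nx p \<or> p = nx q" if pq: "p \<in> ?C" "q \<in> ?C" for p q
    proof -
      obtain i j where ij: "i < n" "p = h (i mod n)" "j < n" "q = h (j mod n)" using C[OF pq(1)] C[OF pq(2)] by blast
      then have "p \<sim> q \<longleftrightarrow> j = Suc i mod n \<or> i = Suc j mod n"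
        using h unfolding hole_def by simp
      also have "\<dots> \<longleftrightarrow> q = nx p \<or> p = nx q"
        using ij nx_h[of i] nx_h[of j] h_eq[of j "Suc i mod n"] h_eq[of i "Suc j mod n"] n by simp
      finally show ?thesis .
    qed
    show "nx p \<noteq> p" "nx (nx p) \<noteq> p" "nx (nx (nx p)) \<noteq> p" "nx (nx (nx (nx p))) \<noteq> p"
      if p: "p \<in> ?C" for p
    proof -
      obtain i where i: "i < n" "p = h (i mod n)" using C[OF p] by blast
      show "nx p \<noteq> p" "nx (nx p) \<noteq> p" "nx (nx (nx p)) \<noteq> p" "nx (nx (nx (nx p))) \<noteq> p"
        unfolding i(2) nx_h using shift[of 1 i] shift[of 2 i] shift[of 3 i] shift[of 4 i] i(1) n
        by (simp_all add: numeral_eq_Suc)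
    qed
    show "U = ?C" if U: "U \<subseteq> ?C" "U \<noteq> {}" "\<And>p. p \<in> U \<Longrightarrow> nx p \<in> U" for U
    proof -
      obtain i where i: "i < n" "h (i mod n) \<in> U" using U(1,2) C by (metis subsetD ex_in_conv)
      have all: "h ((i + k) mod n) \<in> U" for k
      proof (induction k)
        case 0
        then show ?case using i by simp
      next
        case (Suc k)
        then show ?case using U(3)[OF Suc] nx_h[of "i + k"] by simp
      qed
      \<comment> \<open>From index \<open>i\<close>, \<open>n - i + j\<close> steps lead to
        \<open>j\<close> modulo \<open>n\<close>.\<close>
      have "h j \<in> U" if "j < n" for j
        using all[of "n - i + j"] that i by simp
      then show ?thesis using U(1) by blast
    qed
    show "\<exists>p\<in>?C. \<not> u \<sim> p"
      if "u \<in> V" "w \<in> V" "u \<sim> w" "\<And>p. p \<in> ?C \<Longrightarrow> \<not> w \<sim> p" for u w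
      using no_hub[OF that(1-3)] that(4) by blast
  qed
  then show ?thesis by blast
qed

text \<open>Otherwise the complement has a component \<open>P\<close> on \<open>?X\<close> with at
  least two vertices, and some \<open>q\<close> in \<open>D\<close> is mixed on it. But for
  nonadjacent \<open>y\<close>, \<open>z\<close> in \<open>P\<close>, the fork at \<open>s\<close>
  with leaves \<open>w\<close>, \<open>z\<close> and branch \<open>y\<close>, \<open>q\<close>
  carries adjacency to \<open>q\<close> from \<open>y\<close> to \<open>z\<close>.\<close>

lemma min_imperfect_attachment_cliq:
  assumes D: "D \<subseteq> V" "min_imperfect D" and s: "s \<in> V" "w \<in> V" "s \<sim> w"
    and w: "w \<notin> D" "\<And>d. d \<in> D \<Longrightarrow> \<not> w \<sim> d" and y0: "y0 \<in> D" "\<not> s \<sim> y0"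
  shows "cliq {x \<in> D. s \<sim> x}"
proof (rule ccontr)
  let ?X = "{x \<in> D. s \<sim> x}"
  let ?R = "{(a, b). a \<in> ?X \<and> b \<in> ?X \<and> \<not> a \<sim> b}"
  assume "\<not> cliq ?X"
  then obtain x1 x2 where x: "x1 \<in> ?X" "x2 \<in> ?X" "x1 \<noteq> x2" "\<not> x1 \<sim> x2"
    unfolding cliq_def by blast
  define P where "P = {z. (x1, z) \<in> ?R\<^sup>*}"
  have P_X: "P \<subseteq> ?X"
  proof
    fix z assume "z \<in> P"
    then have "(x1, z) \<in> ?R\<^sup>*" unfolding P_def by blast
    then show "z \<in> ?X" using x(1) by (induction rule: rtrancl_induct) auto
  qed
  have step: "b \<in> P" if "a \<in> P" "b \<in> ?X" "\<not> a \<sim> b" for a b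
  proof -
    have "(a, b) \<in> ?R" using that P_X by blast
    then show ?thesis using that(1) unfolding P_def by (simp add: rtrancl_into_rtrancl)
  qed
  have "x1 \<in> P" unfolding P_def by simp
  moreover from this have "x2 \<in> P" using step x by blast
  moreover have "P \<subset> D" using P_X y0 by blast
  ultimately obtain q a b where q: "q \<in> D - P" "a \<in> P" "b \<in> P" "q \<sim> a" "\<not> q \<sim> b"
    using min_imperfect_no_homogeneous[OF D(2), of P x1 x2] x(3) by blast
  \<comment> \<open>As \<open>q\<close> misses \<open>b\<close> in \<open>P\<close>, membership in
    \<open>?X\<close> would put \<open>q\<close> into \<open>P\<close>.\<close>
  have sq: "\<not> s \<sim> q" using step[of b q] q adj_sym by blast
  have "(x1, z) \<in> ?R\<^sup>* \<Longrightarrow> q \<sim> x1 \<Longrightarrow> q \<sim> z" for z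
  proof (induction rule: rtrancl_induct)
    case base
    then show ?case by blast
  next
    case (step y z)
    have yz: "y \<in> D" "z \<in> D" "s \<sim> y" "s \<sim> z" "\<not> y \<sim> z" and qy: "q \<sim> y" using step by blast+
    have "{s, w, z, y, q} \<subseteq> V" using s yz q(1) D(1) by blast
    moreover have "w \<noteq> z" "\<not> w \<sim> z" "\<not> w \<sim> y" "\<not> w \<sim> q" using w yz q(1) by blast+
    ultimately show ?case
      using no_fork[of s w z y q] s(3) yz adj_sym[OF qy] sq adj_commute[of z y] adj_commute[of z q]
      by blast
  qed
  moreover have "(x1, z) \<in> ?R\<^sup>* \<Longrightarrow> \<not> q \<sim> x1 \<Longrightarrow> \<not> q \<sim> z" for z
  proof (induction rule: rtrancl_induct)
    case base
    then show ?case by blast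
  next
    case (step y z)
    have yz: "y \<in> D" "z \<in> D" "s \<sim> y" "s \<sim> z" "\<not> y \<sim> z" and qy: "\<not> q \<sim> y" using step by blast+
    show ?case
    proof
      assume qz: "q \<sim> z"
      have "{s, w, y, z, q} \<subseteq> V" using s yz q(1) D(1) by blast
      moreover have "w \<noteq> y" "\<not> w \<sim> z" "\<not> w \<sim> y" "\<not> w \<sim> q" using w yz q(1) by blast+
      ultimately show False
        using no_fork[of s w y z q] s(3) yz adj_sym[OF qz] qy sq adj_commute[of y q] by blast
    qed
  qed
  ultimately show False using q P_def by blast
qed

text \<open>The conditions \<open>cliq_nbrs\<close> and \<open>fork_nbrs\<close> come from forks
  with centre \<open>x\<close> and long branch \<open>s\<close>, \<open>w\<close>, and with centre
  \<open>y\<close> and long branch \<open>x\<close>, \<open>s\<close>.\<close>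

lemma min_imperfect_attachment_odd_hole:
  assumes D: "D \<subseteq> V" "min_imperfect D" and s: "s \<in> V" "w \<in> V" "s \<sim> w"
    and w: "w \<notin> D" "\<And>d. d \<in> D \<Longrightarrow> \<not> w \<sim> d" and x0: "x0 \<in> D" "s \<sim> x0" and y0: "y0 \<in> D" "\<not> s \<sim> y0"
  shows "odd_hole_in D"
proof (rule ccontr)
  assume no_hole: "\<not> odd_hole_in D"
  let ?X = "{x \<in> D. s \<sim> x}"
  interpret kempe adj D ?X "om D"
  proof unfold_locales
    show "finite D" using D(2) unfolding min_imperfect_def by blast
    show "cliq ?X" by (rule min_imperfect_attachment_cliq[OF D s w y0])
    show "cliq {y \<in> D - ?X. x \<sim> y}" if x: "x \<in> ?X" for x
      unfolding cliq_def
    proof (intro ballI impI)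
      fix y z assume yz: "y \<in> {y \<in> D - ?X. x \<sim> y}" "z \<in> {y \<in> D - ?X. x \<sim> y}" "y \<noteq> z"
      have "{x, y, z, s, w} \<subseteq> V" using x yz s D(1) by blast
      then show "y \<sim> z"
        using no_fork[of x y z s w] x yz s w adj_commute by blast
    qed
    show "x \<sim> y1 \<or> x \<sim> y2 \<or> y1 \<sim> y2"
      if x: "x \<in> ?X" and y: "y \<in> D - ?X" "y1 \<in> D - ?X" "y2 \<in> D - ?X"
        "y \<sim> x" "y \<sim> y1" "y \<sim> y2" "y1 \<noteq> y2" for x y y1 y2
    proof -
      have "{y, y1, y2, x, s} \<subseteq> V" using x y s D(1) by blast
      then show ?thesis
        using no_fork[of y y1 y2 x s] x y adj_commute by blast
    qed
    show "\<not> odd_hole_in D" by (rule no_hole)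
    show "\<not> colouring D (om D) c" for c by (rule min_imperfect_not_colouring[OF D(2)])
  qed auto
  obtain c where "colouring (D - {x0}) (om D) c"
    using min_imperfect_colouring_delete[OF D(2) x0(1)] by blast
  then have "near_colouring c x0" unfolding near_colouring_def using x0 by blast
  then show False using no_near_colouring by blast
qed

text \<open>
  Otherwise every neighbour of the set \<open>W\<close> of vertices anticomplete to \<open>D\<close> is complete to \<open>D\<close>, and a
  maximal anticonnected superset of \<open>D\<close> that stays off \<open>W\<close> and complete to its neighbours is
  homogeneous.
\<close>

lemma ex_mixed_attachment:
  assumes H: "H \<subseteq> V" and D: "D \<subseteq> H" "min_imperfect D"
    and w0: "w0 \<in> H - D" "\<And>d. d \<in> D \<Longrightarrow> \<not> w0 \<sim> d"
    and no_hom: "\<And>P. D \<subseteq> P \<Longrightarrow> P \<subset> H \<Longrightarrow> \<exists>q\<in>H - P. \<exists>a\<in>P. \<exists>b\<in>P. q \<sim> a \<and> \<not> q \<sim> b"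
  shows "\<exists>s\<in>H. \<exists>w\<in>H. s \<sim> w \<and> w \<notin> D \<and> (\<forall>d\<in>D. \<not> w \<sim> d) \<and> (\<exists>d\<in>D. s \<sim> d) \<and> (\<exists>d\<in>D. \<not> s \<sim> d)"
proof (rule ccontr)
  assume neg: "\<not> ?thesis"
  define W where "W = {x \<in> H - D. \<forall>d\<in>D. \<not> x \<sim> d}"
  define S where "S = {s \<in> H - W. \<exists>w\<in>W. s \<sim> w}"
  define anticonnected where "anticonnected P \<longleftrightarrow>
    (\<forall>U. U \<subseteq> P \<longrightarrow> U \<noteq> {} \<longrightarrow> U \<noteq> P \<longrightarrow> (\<exists>u\<in>U. \<exists>v\<in>P - U. \<not> u \<sim> v))" for P
  define F where "F = {P. D \<subseteq> P \<and> P \<subseteq> H - W - S \<and> anticonnected P \<and> (\<forall>s\<in>S. \<forall>p\<in>P. s \<sim> p)}"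
  have S_D: "s \<sim> d" if sd: "s \<in> S" "d \<in> D" for s d
  proof -
    obtain w where w: "w \<in> W" "s \<sim> w" using sd(1) unfolding S_def by blast
    have "s \<notin> D" using w adj_sym unfolding W_def by blast
    then have "\<exists>d\<in>D. s \<sim> d" using sd(1) unfolding S_def W_def by blast
    then show ?thesis using neg w sd unfolding S_def W_def by blast
  qed
  have "D \<inter> W = {}" "D \<inter> S = {}" using S_D adj_irrefl unfolding W_def by blast+
  moreover have "anticonnected D"
    unfolding anticonnected_def using min_imperfect_anticonnected[OF D(2)] by blast
  ultimately have "D \<in> F" unfolding F_def using D(1) S_D by blast
  moreover have "finite F"
    by (rule finite_subset[of _ "Pow V"]) (use H finite_V in \<open>auto simp: F_def\<close>)
  ultimately obtain P where P_F: "P \<in> F" and max: "\<forall>Q\<in>F. P \<subseteq> Q \<longrightarrow> P = Q"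
    using finite_has_maximal[of F] by blast
  have P: "D \<subseteq> P" "P \<subseteq> H - W - S" "anticonnected P" "\<forall>s\<in>S. \<forall>p\<in>P. s \<sim> p"
    using P_F unfolding F_def by blast+
  have "w0 \<in> W" using w0 unfolding W_def by blast
  then have "P \<subset> H" using P unfolding W_def by blast
  then obtain q a b where q: "q \<in> H - P" "a \<in> P" "b \<in> P" "q \<sim> a" "\<not> q \<sim> b"
    using no_hom[of P] P by blast
  have "q \<notin> S" using q P by blast
  moreover have "q \<notin> W"
  proof
    assume "q \<in> W"
    then have "a \<in> S" using q P adj_sym unfolding S_def by blast
    then show False using q P by blast
  qed
  moreover have "anticonnected (insert q P)"
    unfolding anticonnected_def
  proof (intro allI impI)
    fix U assume U: "U \<subseteq> insert q P" "U \<noteq> {}" "U \<noteq> insert q P"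
    have P_anti: "\<exists>u\<in>U'. \<exists>v\<in>P - U'. \<not> u \<sim> v" if "U' \<subseteq> P" "U' \<noteq> {}" "U' \<noteq> P" for U'
      using P that unfolding anticonnected_def by blast
    show "\<exists>u\<in>U. \<exists>v\<in>insert q P - U. \<not> u \<sim> v"
    proof (cases "q \<in> U")
      case True
      show ?thesis
      proof (cases "U - {q} = {}")
        case True
        then have "U = {q}" using U(2) by blast
        then show ?thesis using q by blast
      next
        case False
        moreover have "U - {q} \<noteq> P" using U(3) True by blast
        ultimately obtain u v where "u \<in> U - {q}" "v \<in> P - (U - {q})" "\<not> u \<sim> v"
          using P_anti[of "U - {q}"] U(1) by blast
        then show ?thesis using q(1) by blast
      qed
    next
      case False
      then have "U \<subseteq> P" using U(1) by blast
      show ?thesis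
      proof (cases "U = P")
        case True
        then show ?thesis using q adj_sym by blast
      next
        case False
        then show ?thesis using P_anti[OF \<open>U \<subseteq> P\<close> U(2)] by blast
      qed
    qed
  qed
  \<comment> \<open>Anticonnectedness of \<open>P\<close> provides nonadjacent \<open>d\<close>,
    \<open>d'\<close> that \<open>q\<close> distinguishes; they would give a fork at
    \<open>s\<close> with leaves \<open>w\<close>, \<open>d'\<close> and long branch
    \<open>d\<close>, \<open>q\<close>.\<close>
  moreover have "s \<sim> q" if s: "s \<in> S" for s
  proof (rule ccontr)
    assume sq: "\<not> s \<sim> q"
    let ?U = "{x \<in> P. q \<sim> x}"
    have "?U \<subseteq> P" "?U \<noteq> {}" "?U \<noteq> P" using q by blast+
    then obtain d d' where d: "d \<in> ?U" "d' \<in> P - ?U" "\<not> d \<sim> d'"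
      using P(3) unfolding anticonnected_def by meson
    obtain w where w: "w \<in> W" "s \<sim> w" using s unfolding S_def by blast
    have wP: "\<not> w \<sim> x" if "x \<in> H" "x \<notin> W" "x \<notin> S" for x
    proof
      assume "w \<sim> x"
      then have "x \<sim> w" by (rule adj_sym)
      then show False using that w(1) unfolding S_def by blast
    qed
    have "{s, w, d', d, q} \<subseteq> V" using s w d q(1) P H unfolding S_def W_def by blast
    moreover have "s \<sim> d" "s \<sim> d'" using s d P by blast+
    moreover have "\<not> w \<sim> d" "\<not> w \<sim> d'" "\<not> w \<sim> q"
      using wP d P q(1) \<open>q \<notin> W\<close> \<open>q \<notin> S\<close> by blast+
    moreover have "w \<noteq> d'" using d P w by blast
    ultimately show False
      using no_fork[of s w d' d q] w d sq adj_commute[of d' d] adj_commute[of d q] adj_commute[of d' q]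
      by blast
  qed
  ultimately have "insert q P \<in> F" unfolding F_def using P q(1) by blast
  then show False using max q(1) by blast
qed

end

locale fork_parachute_free = fork_free +
  assumes no_parachute: "\<And>n h u w. odd n \<Longrightarrow> 5 \<le> n \<Longrightarrow> hole n h \<Longrightarrow> h ` {..<n} \<subseteq> V \<Longrightarrow>
    u \<in> V \<Longrightarrow> w \<in> V \<Longrightarrow> u \<sim> w \<Longrightarrow> (\<And>i. i < n \<Longrightarrow> u \<sim> h i) \<Longrightarrow> \<exists>i<n. w \<sim> h i"
begin

text \<open>The vertex \<open>w\<close> may be too far from the hole. On the way along
  \<open>w\<close>, \<open>s\<close>, \<open>x0\<close> and on through the connected set
  \<open>D\<close>, which contains the hole, some edge leads from a far vertex to one that is not
  far.\<close>

lemma ex_trisimplicial_of_attachment: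
  assumes D: "D \<subseteq> V" "min_imperfect D" and s: "s \<in> V" "w \<in> V" "s \<sim> w"
    and w: "w \<notin> D" "\<And>d. d \<in> D \<Longrightarrow> \<not> w \<sim> d" and x0: "x0 \<in> D" "s \<sim> x0" and y0: "y0 \<in> D" "\<not> s \<sim> y0"
  shows "\<exists>v\<in>V. \<exists>K1 K2 K3. cliq K1 \<and> cliq K2 \<and> cliq K3 \<and> {u \<in> V. u \<sim> v} = K1 \<union> K2 \<union> K3"
proof -
  obtain n h where h: "odd n" "5 \<le> n" "hole n h" "h ` {..<n} \<subseteq> D"
    using min_imperfect_attachment_odd_hole[OF D s w x0 y0] unfolding odd_hole_in_def by blast
  let ?C = "h ` {..<n}"
  have CV: "?C \<subseteq> V" using h(4) D(1) by blast
  obtain nx where "fork_free_cycle adj V ?C nx"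
    using hole_fork_free_cycle[OF h(2,3) CV] no_parachute[OF h(1-3) CV] by blast
  then interpret fork_free_cycle adj V ?C nx .
  have far_w: "far w" using w h(4) s(2) unfolding far_def by blast
  have "\<exists>v u. far v \<and> u \<in> V \<and> u \<sim> v \<and> \<not> far u"
  proof (cases "far s \<and> far x0")
    case False
    then show ?thesis using far_w s x0 D(1) adj_sym by blast
  next
    case True
    let ?F = "{x \<in> D. far x}"
    have "h 0 \<in> ?C" using h(2) by simp
    then have "h 0 \<in> D" "\<not> far (h 0)" using h(4) farD(4) by blast+
    then have "?F \<noteq> D" by blast
    moreover have "?F \<noteq> {}" using True x0 by blast
    ultimately obtain f g where "f \<in> ?F" "g \<in> D - ?F" "f \<sim> g"
      using min_imperfect_connected[OF D(2), of ?F] by blast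
    then show ?thesis using D(1) adj_sym by blast
  qed
  then obtain v u where v: "far v" "u \<in> V" "u \<sim> v" "\<not> far u" by blast
  moreover have "\<exists>p. attached u p" using far_nbr_cases[OF v(1-3)] v(4) by blast
  ultimately have "\<exists>u\<in>{u \<in> V. u \<sim> v}. \<exists>p. attached u p" by blast
  then show ?thesis using far_nbrs_three_cliqs[OF v(1) refl] farD(1)[OF v(1)] by blast
qed

end

context adjacency
begin

section \<open>Minimal indivisible sets\<close>

definition divisible :: "'a set \<Rightarrow> bool" where
  "divisible H \<longleftrightarrow> (\<exists>A B. A \<union> B = H \<and> A \<inter> B = {} \<and> perf A \<and> om B < om H)"

text \<open>
  Divide \<open>H\<close> with \<open>P\<close> replaced by a maximum clique \<open>K\<close> of \<open>P\<close>. If \<open>K\<close> lies in the second part,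
  put all of \<open>P\<close> there; otherwise substitute the two parts of a division of \<open>P\<close>.
\<close>

lemma min_indivisible_no_homogeneous:
  assumes fin: "finite H" and ndiv: "\<not> divisible H"
    and min: "\<And>T. T \<subset> H \<Longrightarrow> T \<noteq> {} \<Longrightarrow> divisible T"
    and P: "P \<subset> H" "\<not> perf P"
  shows "\<exists>q\<in>H - P. \<exists>a\<in>P. \<exists>b\<in>P. q \<sim> a \<and> \<not> q \<sim> b"
proof (rule ccontr)
  assume "\<not> ?thesis"
  then have hom: "q \<sim> b" if "q \<in> H - P" "a \<in> P" "b \<in> P" "q \<sim> a" for q a b using that by blast
  have finP: "finite P" using fin P(1) by (meson finite_subset psubset_imp_subset)
  obtain K where K: "K \<subseteq> P" "cliq K" "card K = om P" using ex_max_cliq[OF finP] by blast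
  have finK: "finite K" using K(1) finP finite_subset by blast
  \<comment> \<open>\<open>P\<close> is imperfect and hence no clique; this makes \<open>?H\<close>
    smaller than \<open>H\<close>.\<close>
  have K_P: "K \<noteq> P" using cliq_perf[OF finK K(2)] P(2) by blast
  let ?H = "(H - P) \<union> K"
  have H: "?H \<subset> H" "?H \<noteq> {}" using K(1) K_P P(1) by blast+
  obtain A B where AB: "A \<union> B = ?H" "A \<inter> B = {}" "perf A" "om B < om ?H"
    using min[OF H] unfolding divisible_def by blast
  have om_H: "om ?H \<le> om H" using om_mono[OF fin] H(1) by blast
  have finB: "finite B" using AB(1) H(1) by (intro finite_subset[OF _ fin]) blast
  have join: "cliq ((L - P) \<union> K')" if "cliq L" "L \<subseteq> H" "l \<in> L \<inter> P" "cliq K'" "K' \<subseteq> P" for L K' l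
  proof (rule cliq_Un)
    show "cliq (L - P)" using that(1) by (rule cliq_subset) blast
    fix x y assume "x \<in> L - P" "y \<in> K'"
    moreover from this have "x \<sim> l" using cliqD[OF that(1), of x l] that(3) by blast
    ultimately show "x \<sim> y" using hom[of x l y] that by blast
  qed (use that in blast)
  have card_join: "card ((L - P) \<union> K') = card (L - P) + card K'"
    if "finite L" "K' \<subseteq> P" for L K'
    by (rule card_Un_disjoint) (use that finite_subset[OF that(2) finP] in auto)
  have card_split: "card L = card (L - P) + card (L \<inter> P)" if "finite L" for L
    using card_Un_disjoint[of "L - P" "L \<inter> P"] that
    by (metis Diff_disjoint Int_Diff Un_Diff_Int finite_Diff finite_Int inf_commute)
  show False
  proof (cases "K \<subseteq> B")
    case True
    let ?B = "(B - K) \<union> P"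
    \<comment> \<open>In a clique that meets \<open>P\<close>, the part inside \<open>P\<close> can
      be exchanged for \<open>K\<close>, which is at least as large and lies in
      \<open>B\<close>.\<close>
    have "om ?B \<le> om B"
    proof (rule om_leI)
      show "finite ?B" using finB finP by blast
      fix L assume L: "L \<subseteq> ?B" "cliq L"
      have finL: "finite L" using L(1) finB finP by (meson finite_Diff finite_UnI finite_subset)
      show "card L \<le> om B"
      proof (cases "L \<inter> P = {}")
        case True
        then show ?thesis using L by (intro card_le_om[OF finB]) blast+
      next
        case False
        then obtain l where l: "l \<in> L \<inter> P" by blast
        have LH: "L \<subseteq> H" using L(1) AB(1) P(1) K(1) by blast
        have "cliq ((L - P) \<union> K)" using join[OF L(2) LH l K(2,1)] .
        moreover have "(L - P) \<union> K \<subseteq> B" using L(1) True by blast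
        ultimately have "card ((L - P) \<union> K) \<le> om B" by (intro card_le_om[OF finB])
        moreover have "card (L \<inter> P) \<le> card K"
          using card_le_om[OF finP, of "L \<inter> P"] K(3) cliq_subset[OF L(2)] by simp
        ultimately show ?thesis using card_join[OF finL K(1)] card_split[OF finL] by linarith
      qed
    qed
    then have "om ?B < om H" using AB(4) om_H by linarith
    moreover have "A \<union> ?B = H" using AB(1) True K(1) P(1) by blast
    moreover have "A \<inter> ?B = {}" using AB(1,2) True by blast
    ultimately show False using ndiv AB(3) unfolding divisible_def by blast
  next
    case False
    \<comment> \<open>One vertex of \<open>K\<close> in \<open>A\<close> is enough:
      \<open>A'\<close> is substituted for it, and the rest of \<open>K\<close> is dropped from both
      parts.\<close>
    then obtain k where k: "k \<in> K" "k \<in> A" using AB(1) by blast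
    have "P \<noteq> {}" using K(1) k(1) by blast
    then obtain A' B' where AB': "A' \<union> B' = P" "A' \<inter> B' = {}" "perf A'" "om B' < om P"
      using min[OF P(1)] unfolding divisible_def by blast
    have finB': "finite B'" using AB'(1) by (intro finite_subset[OF _ finP]) blast
    let ?A = "A' \<union> (A - P)" and ?B = "(B - P) \<union> B'"
    have "perf ?A"
    proof (rule perf_substitution)
      show "perf (insert k (A - P))" by (rule perf_subset[OF AB(3)]) (use k(2) in blast)
      show "finite A'" "finite (A - P)"
        using AB(1) AB'(1) H(1) P(1) by (intro finite_subset[OF _ fin]; blast)+
      show "k \<notin> A - P" using k(1) K(1) by blast
      show "A' \<inter> (A - P) = {}" using AB'(1) by blast
      show "perf A'" by (rule AB'(3))
      fix q assume "q \<in> A - P"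
      then have q: "q \<in> H - P" using AB(1) H(1) by blast
      have kP: "insert k A' \<subseteq> P" using k(1) K(1) AB'(1) by blast
      show "(\<forall>p\<in>insert k A'. q \<sim> p) \<or> (\<forall>p\<in>insert k A'. \<not> q \<sim> p)"
        using hom[OF q] kP by blast
    qed
    \<comment> \<open>For a clique that meets \<open>P\<close>, strictness comes from
      \<open>om B' < om P\<close>: exchanging its part in \<open>P\<close> for \<open>K\<close>
      gives a larger clique of \<open>H\<close>.\<close>
    moreover have "om ?B < om H"
    proof (rule om_lessI)
      show "finite ?B" using finB finB' by blast
      fix L assume L: "L \<subseteq> ?B" "cliq L"
      have finL: "finite L" using L(1) finB finB' by (meson finite_Diff finite_UnI finite_subset)
      show "card L < om H"
      proof (cases "L \<inter> P = {}")
        case True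
        have "L \<subseteq> B" using L(1) AB'(1) True by blast
        then have "card L \<le> om B" using L(2) by (intro card_le_om[OF finB])
        then show ?thesis using AB(4) om_H by linarith
      next
        case False
        then obtain l where l: "l \<in> L \<inter> P" by blast
        have LH: "L \<subseteq> H" using L(1) AB(1) AB'(1) P(1) H(1) by blast
        have "cliq ((L - P) \<union> K)" using join[OF L(2) LH l K(2,1)] .
        moreover have "(L - P) \<union> K \<subseteq> H" using LH K(1) P(1) by blast
        ultimately have "card ((L - P) \<union> K) \<le> om H" by (intro card_le_om[OF fin])
        moreover have "L \<inter> P \<subseteq> B'" using L(1) by blast
        then have "card (L \<inter> P) \<le> om B'"
          using cliq_subset[OF L(2)] by (intro card_le_om[OF finB']) auto
        ultimately show ?thesis
          using card_join[OF finL K(1)] card_split[OF finL] AB'(4) K(3) by linarith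
      qed
    qed
    moreover have "?A \<union> ?B = H" using AB(1) AB'(1) P(1) K(1) by blast
    moreover have "?A \<inter> ?B = {}" using AB(2) AB'(1,2) by blast
    ultimately show False using ndiv unfolding divisible_def by blast
  qed
qed

text \<open>Otherwise non-neighbours and neighbours of \<open>v\<close> divide \<open>H\<close>,
  because \<open>v\<close> extends every clique among its neighbours.\<close>

lemma indivisible_non_nbrs_imperfect:
  assumes fin: "finite H" and ndiv: "\<not> divisible H" and v: "v \<in> H"
  shows "\<not> perf {x \<in> H. \<not> x \<sim> v}"
proof
  assume perf: "perf {x \<in> H. \<not> x \<sim> v}"
  have "om {x \<in> H. x \<sim> v} < om H"
  proof (rule om_lessI)
    show fin': "finite {x \<in> H. x \<sim> v}" using fin by simp
    fix K assume K: "K \<subseteq> {x \<in> H. x \<sim> v}" "cliq K"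
    then have "cliq (insert v K)" using adj_sym by (intro cliq_insert) blast+
    moreover have "insert v K \<subseteq> H" using K(1) v by blast
    ultimately have "card (insert v K) \<le> om H" by (intro card_le_om[OF fin])
    moreover have "v \<notin> K" using K(1) adj_irrefl by blast
    ultimately show "card K < om H" using finite_subset[OF K(1) fin'] by simp
  qed
  moreover have "{x \<in> H. \<not> x \<sim> v} \<union> {x \<in> H. x \<sim> v} = H" by blast
  moreover have "{x \<in> H. \<not> x \<sim> v} \<inter> {x \<in> H. x \<sim> v} = {}" by blast
  ultimately show False using ndiv perf unfolding divisible_def by blast
qed

end

lemma (in fork_parachute_free) ex_trisimplicial:
  assumes H: "H \<subseteq> V" "H \<noteq> {}" "\<not> divisible H"
  shows "\<exists>v\<in>V. \<exists>K1 K2 K3. cliq K1 \<and> cliq K2 \<and> cliq K3 \<and> {u \<in> V. u \<sim> v} = K1 \<union> K2 \<union> K3"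
proof -
  define F where "F = {T. T \<subseteq> H \<and> T \<noteq> {} \<and> \<not> divisible T}"
  have "finite F"
    by (rule finite_subset[of _ "Pow V"]) (use H(1) finite_V in \<open>auto simp: F_def\<close>)
  moreover have "F \<noteq> {}" using H unfolding F_def by blast
  ultimately obtain M where M_F: "M \<in> F" and min: "\<forall>T\<in>F. T \<subseteq> M \<longrightarrow> M = T"
    using finite_has_minimal[of F] by blast
  have M: "M \<subseteq> H" "M \<noteq> {}" "\<not> divisible M" using M_F unfolding F_def by blast+
  have MV: "M \<subseteq> V" using M H(1) by blast
  then have finM: "finite M" using finite_V by (rule finite_subset)
  have divs: "divisible T" if "T \<subset> M" "T \<noteq> {}" for T
    using min that M(1) unfolding F_def by blast
  obtain v where v: "v \<in> M" using M by blast
  let ?A = "{x \<in> M. \<not> x \<sim> v}"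
  have "\<not> perf ?A" using indivisible_non_nbrs_imperfect[OF finM M(3) v] .
  then obtain D where D: "D \<subseteq> ?A" "min_imperfect D"
    using ex_min_imperfect[of ?A] finM by auto
  have DM: "D \<subseteq> M" using D(1) by blast
  have v_D: "\<not> v \<sim> d" if "d \<in> D" for d using that D(1) adj_sym by blast
  \<comment> \<open>Otherwise \<open>v\<close> would be isolated in \<open>D\<close>, which is
    connected and has more than one vertex.\<close>
  have "v \<notin> D"
  proof
    assume vD: "v \<in> D"
    have "perf {v}" by (rule cliq_perf) (simp_all add: cliq_def)
    then have "{v} \<noteq> D" using D(2) unfolding min_imperfect_def by blast
    then show False using min_imperfect_connected[OF D(2), of "{v}"] vD v_D by blast
  qed
  then have v': "v \<in> M - D" using v by blast
  have "\<exists>q\<in>M - P. \<exists>a\<in>P. \<exists>b\<in>P. q \<sim> a \<and> \<not> q \<sim> b" if P: "D \<subseteq> P" "P \<subset> M" for P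
  proof -
    have "\<not> perf P" using D(2) perf_subset P(1) unfolding min_imperfect_def by blast
    then show ?thesis
      using min_indivisible_no_homogeneous[OF finM M(3) divs P(2)] by blast
  qed
  then obtain s w x y where "s \<in> M" "w \<in> M" "s \<sim> w" "w \<notin> D" "\<forall>d\<in>D. \<not> w \<sim> d" "x \<in> D" "s \<sim> x" "y \<in> D" "\<not> s \<sim> y"
    using ex_mixed_attachment[OF MV DM D(2) v' v_D] by blast
  then show ?thesis
    using ex_trisimplicial_of_attachment[of D s w x y] D(2) DM MV by blast
qed

section \<open>Graphs as records\<close>

lemma induce_induce: "T \<subseteq> X \<Longrightarrow> induce (induce G X) T = induce G T"
  by (auto simp: induce_def)

lemma verts_induce [simp]: "verts (induce G X) = X"
  by (simp add: induce_def)

lemma contains_inducedI: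
  assumes inj: "inj_on f (verts F)" and sub: "f ` verts F \<subseteq> verts G"
    and edge: "\<And>u v. u \<in> verts F \<Longrightarrow> v \<in> verts F \<Longrightarrow> {u, v} \<in> edges F \<longleftrightarrow> {f u, f v} \<in> edges G"
  shows "contains_induced G F"
proof -
  have "induced_subgraph (induce G (f ` verts F)) G"
    unfolding induced_subgraph_def using sub by blast
  moreover have "graph_iso F (induce G (f ` verts F))"
    unfolding graph_iso_def
    by (rule exI[of _ f]) (use inj edge in \<open>auto simp: bij_betw_def induce_def\<close>)
  ultimately show ?thesis unfolding contains_induced_def by blast
qed

lemma edges_cycle_graph_iff:
  assumes "i < n" "j < n"
  shows "{i, j} \<in> edges (cycle_graph n) \<longleftrightarrow> j = Suc i mod n \<or> i = Suc j mod n"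
  using assms by (auto simp: cycle_graph_def doubleton_eq_iff)

lemma edges_cycle_graph_less: "{i, j} \<in> edges (cycle_graph n) \<Longrightarrow> i < n \<and> j < n"
  by (auto simp: cycle_graph_def doubleton_eq_iff)

lemma edges_parachute_iff:
  "{i, j} \<in> edges (parachute n) \<longleftrightarrow> {i, j} \<in> edges (cycle_graph n) \<or>
    i = n \<and> j < n \<or> j = n \<and> i < n \<or> i = n \<and> j = Suc n \<or> j = n \<and> i = Suc n"
  by (auto simp: parachute_def cycle_graph_def doubleton_eq_iff)

locale simple_ugraph =
  fixes G :: "'a ugraph"
  assumes simple: "simple_graph G"

sublocale simple_ugraph \<subseteq> adjacency "\<lambda>u v. {u, v} \<in> edges G"
proof
  show "{y, x} \<in> edges G" if "{x, y} \<in> edges G" for x y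
    using that by (simp add: insert_commute)
  show "{x, x} \<notin> edges G" for x
    using simple unfolding simple_graph_def by fastforce
qed

context simple_ugraph
begin

lemma finite_verts: "finite (verts G)"
  using simple by (simp add: simple_graph_def)

lemma clique_in_induce_iff: "clique_in (induce G X) K \<longleftrightarrow> K \<subseteq> X \<and> cliq K"
  unfolding clique_in_def clique_def cliq_def by (auto simp: induce_def)

lemma clique_number_induce: "clique_number (induce G X) = om X"
proof -
  have "{card K | K. clique_in (induce G X) K} = card ` {K. K \<subseteq> X \<and> cliq K}"
    by (auto simp: clique_in_induce_iff)
  then show ?thesis unfolding clique_number_def om_def by simp
qed

lemma proper_colouring_induce: "proper_colouring (induce G X) k c \<longleftrightarrow> colouring X k c"
  unfolding proper_colouring_def colouring_def by (auto simp: induce_def)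

text \<open>The \<open>LEAST\<close> is attained only if some colouring exists; an injective
  numbering of the finite set \<open>X\<close> is one.\<close>

lemma chromatic_number_induce_eq_iff:
  assumes "finite X"
  shows "chromatic_number (induce G X) = om X \<longleftrightarrow> (\<exists>c. colouring X (om X) c)"
proof
  obtain f :: "'a \<Rightarrow> nat" where f: "bij_betw f X {0..<card X}"
    using ex_bij_betw_finite_nat[OF assms] by blast
  have "colouring X (card X) f"
  proof (rule colouringI)
    show "f v < card X" if "v \<in> X" for v
      using f that by (auto simp: bij_betw_def)
    show "f u \<noteq> f v" if "u \<in> X" "v \<in> X" "{u, v} \<in> edges G" for u v
      using f that adj_irrefl[of u] by (auto simp: bij_betw_def inj_on_def)
  qed
  then have "\<exists>k c. colouring X k c" by blast
  then have "\<exists>c. colouring X (chromatic_number (induce G X)) c"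
    unfolding chromatic_number_def proper_colouring_induce by (rule LeastI_ex)
  then show "\<exists>c. colouring X (om X) c" if "chromatic_number (induce G X) = om X"
    using that by simp
next
  assume "\<exists>c. colouring X (om X) c"
  then show "chromatic_number (induce G X) = om X"
    unfolding chromatic_number_def proper_colouring_induce
    by (rule Least_equality) (use om_le_colouring[OF assms] in blast)
qed

lemma perfect_induce_iff:
  assumes "X \<subseteq> verts G"
  shows "perfect (induce G X) \<longleftrightarrow> perf X"
proof -
  have "chromatic_number (induce (induce G X) T) = clique_number (induce (induce G X) T) \<longleftrightarrow>
      (\<exists>c. colouring T (om T) c)" if "T \<subseteq> X" for T
    using chromatic_number_induce_eq_iff[of T] finite_verts assms that
    by (simp add: induce_induce clique_number_induce finite_subset)
  then show ?thesis
    unfolding perfect_def induced_subgraph_def perf_def verts_induce by blast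
qed

lemma ex_indivisible:
  assumes "\<not> perfectly_divisible G"
  shows "\<exists>X\<subseteq>verts G. X \<noteq> {} \<and> \<not> divisible X"
proof -
  obtain X where X: "X \<subseteq> verts G" "X \<noteq> {}"
    and nd: "\<nexists>A B. A \<union> B = X \<and> A \<inter> B = {} \<and> perfect (induce (induce G X) A) \<and>
      clique_number (induce (induce G X) B) < clique_number (induce G X)"
    using assms unfolding perfectly_divisible_def induced_subgraph_def by (metis verts_induce)
  have "\<not> divisible X"
  proof
    assume "divisible X"
    then obtain A B where AB: "A \<union> B = X" "A \<inter> B = {}" "perf A" "om B < om X"
      unfolding divisible_def by blast
    then have "A \<subseteq> X" "B \<subseteq> X" "A \<subseteq> verts G" using X(1) by blast+
    then have "perfect (induce (induce G X) A)"
      "clique_number (induce (induce G X) B) < clique_number (induce G X)"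
      using AB(3,4) by (simp_all add: induce_induce clique_number_induce perfect_induce_iff)
    then show False using nd AB(1,2) by blast
  qed
  then show ?thesis using X by blast
qed

lemma fork_freeI:
  assumes "\<not> contains_induced G fork"
  shows "fork_free (\<lambda>u v. {u, v} \<in> edges G) (verts G)"
proof unfold_locales
  show "finite (verts G)" by (rule finite_verts)
  fix a b c d e
  assume V: "{a, b, c, d, e} \<subseteq> verts G" and e: "{a, b} \<in> edges G" "{a, c} \<in> edges G"
    "{a, d} \<in> edges G" "{d, e} \<in> edges G" and bc: "b \<noteq> c"
  show "{b, c} \<in> edges G \<or> {b, d} \<in> edges G \<or> {b, e} \<in> edges G \<or> {c, d} \<in> edges G \<or>
    {c, e} \<in> edges G \<or> {a, e} \<in> edges G"
  proof (rule ccontr)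
    assume neg: "\<not> ?thesis"
    have sym: "{y, x} \<in> edges G \<longleftrightarrow> {x, y} \<in> edges G" for x y by (simp add: insert_commute)
    have irr: "{x} \<notin> edges G" for x using adj_irrefl[of x] by simp
    \<comment> \<open>The default value \<open>e\<close> is the image of vertex 4, the end of the
      long branch.\<close>
    let ?f = "(\<lambda>_. e)(0 := a, 1 := b, 2 := c, 3 := d)"
    have ne: "a \<noteq> b" "a \<noteq> c" "a \<noteq> d" "a \<noteq> e" "b \<noteq> d" "b \<noteq> e" "c \<noteq> d" "c \<noteq> e" "d \<noteq> e"
      using e neg sym irr by (metis insert_absorb2)+
    have "contains_induced G fork"
    proof (rule contains_inducedI)
      show "inj_on ?f (verts fork)"
        using ne bc by (auto simp: fork_def)
      show "?f ` verts fork \<subseteq> verts G" using V by (auto simp: fork_def)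
      fix u v assume "u \<in> verts fork" "v \<in> verts fork"
      then show "{u, v} \<in> edges fork \<longleftrightarrow> {?f u, ?f v} \<in> edges G"
        using e neg irr sym[of a b] sym[of a c] sym[of a d] sym[of a e] sym[of b c] sym[of b d]
          sym[of b e] sym[of c d] sym[of c e] sym[of d e]
        by (auto simp: fork_def doubleton_eq_iff)
    qed
    then show False using assms by blast
  qed
qed

lemma fork_parachute_freeI:
  assumes "\<not> contains_induced G fork"
    and par: "\<And>P. odd_parachute P \<Longrightarrow> \<not> contains_induced G P"
  shows "fork_parachute_free (\<lambda>u v. {u, v} \<in> edges G) (verts G)"
proof (intro fork_parachute_free.intro fork_parachute_free_axioms.intro fork_freeI assms(1))
  fix n h u w
  assume n: "odd n" "5 \<le> n" and h: "hole n h" "h ` {..<n} \<subseteq> verts G"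
    and u: "u \<in> verts G" "w \<in> verts G" "{u, w} \<in> edges G" "\<And>i. i < n \<Longrightarrow> {u, h i} \<in> edges G"
  show "\<exists>i<n. {w, h i} \<in> edges G"
  proof (rule ccontr)
    assume neg: "\<not> ?thesis"
    have sym: "{y, x} \<in> edges G \<longleftrightarrow> {x, y} \<in> edges G" for x y by (simp add: insert_commute)
    have irr: "{x} \<notin> edges G" for x using adj_irrefl[of x] by simp
    let ?f = "\<lambda>i. if i < n then h i else if i = n then u else w"
    have inj: "h i = h j \<longleftrightarrow> i = j" if "i < n" "j < n" for i j
      using h(1) that unfolding hole_def inj_on_def by auto
    have adj: "{h i, h j} \<in> edges G \<longleftrightarrow> {i, j} \<in> edges (cycle_graph n)" if "i < n" "j < n" for i j
      using h(1) that unfolding hole_def by (simp add: edges_cycle_graph_iff)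
    have uh: "u \<noteq> h i" if "i < n" for i using u(4)[OF that] irr by force
    \<comment> \<open>Each \<open>h i\<close> has a neighbour on the hole, whereas \<open>w\<close>
      has none.\<close>
    have wh: "w \<noteq> h i" if i: "i < n" for i
    proof
      assume "w = h i"
      moreover have "{h i, h (Suc i mod n)} \<in> edges G"
        using h(1) i n unfolding hole_def by auto
      ultimately show False using neg n by auto
    qed
    have uw: "u \<noteq> w" using u(3) irr by auto
    have vP: "verts (parachute n) = {..<n} \<union> {n, Suc n}"
      by (simp add: parachute_def cycle_graph_def)
    have "contains_induced G (parachute n)"
    proof (rule contains_inducedI)
      show "inj_on ?f (verts (parachute n))"
        unfolding vP inj_on_def using inj uh wh uw by fastforce
      show "?f ` verts (parachute n) \<subseteq> verts G"
        unfolding vP using h(2) u by auto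
      fix i j assume "i \<in> verts (parachute n)" "j \<in> verts (parachute n)"
      then have "i < n \<or> i = n \<or> i = Suc n" "j < n \<or> j = n \<or> j = Suc n"
        unfolding vP by auto
      moreover have "{i, j} \<notin> edges (cycle_graph n)" if "\<not> i < n \<or> \<not> j < n"
        using edges_cycle_graph_less that by blast
      ultimately show "{i, j} \<in> edges (parachute n) \<longleftrightarrow> {?f i, ?f j} \<in> edges G"
        unfolding edges_parachute_iff
        using adj[of i j] u neg irr sym[of u w] sym[of u "h i"] sym[of w "h i"] by auto
    qed
    moreover have "odd_parachute (parachute n)" unfolding odd_parachute_def using n by blast
    ultimately show False using par by blast
  qed
qed

end

theorem theorem1p5:
  fixes G :: "'a ugraph"
  assumes "simple_graph G"
    and "\<not> contains_induced G fork"
    and "\<And>P. odd_parachute P \<Longrightarrow> \<not> contains_induced G P"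
    and "\<not> perfectly_divisible G"
  shows "\<exists>v. trisimplicial G v"
proof -
  interpret simple_ugraph G by unfold_locales (rule assms(1))
  interpret fork_parachute_free "\<lambda>u v. {u, v} \<in> edges G" "verts G"
    by (rule fork_parachute_freeI[OF assms(2,3)])
  obtain X where X: "X \<subseteq> verts G" "X \<noteq> {}" "\<not> divisible X"
    using ex_indivisible[OF assms(4)] by blast
  from ex_trisimplicial[OF X] obtain v K1 K2 K3 where v: "v \<in> verts G"
    and K: "cliq K1" "cliq K2" "cliq K3" and N: "{u \<in> verts G. {u, v} \<in> edges G} = K1 \<union> K2 \<union> K3"
    by (elim bexE exE conjE)
  have sub: "K1 \<union> K2 \<union> K3 \<subseteq> verts G" using N by auto
  have "clique_in G K" if "cliq K" "K \<subseteq> K1 \<union> K2 \<union> K3" for K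
    using that sub unfolding clique_in_def clique_def cliq_def by auto
  then have "clique_in G K1" "clique_in G K2" "clique_in G K3" using K by auto
  then have "trisimplicial G v"
    unfolding trisimplicial_def neighbourhood_def using v N by metis
  then show ?thesis by blast
qed

end
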